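(* Let $\omega\in(0,1)\setminus\mathbb{Q}$. There are functions $r_1,r_2,r_3:(0,\infty)\to\mathbb{R}$, depending only on $\omega$, with $r_j(\delta)=O(\delta)$ as $\delta\searrow 0$, such that the following holds. Let $\varrho>0$, $a\in\mathcal{P}_0(\varrho)$, $\delta\in(0,\varrho)$, put $\Delta:=(1+\omega)\delta$, and suppose that $\omega$ is $\Delta$-semi-Brjuno. Then the solution $g$ of the cohomological equation $$(\partial_x+\omega\,\partial_y)\,g(x,y)=a(x,y)$$ exists and satisfies $g\in\mathcal{P}_0(\varrho-\delta)$, and moreover $$\|g\|_{\varrho-\delta}\leqslant\Gamma(\delta)\cdot\|a\|_\varrho,$$ where $$\Gamma(\delta)=(2+r_1(\delta))\,\mathfrak{Brj}(\Delta)+\left(\frac{8}{(1+\omega)^2}+r_2(\delta)\right)\delta^{-2}+\left(\frac{4}{1+\omega}+\frac{2}{1-\omega}+r_3(\delta)\right)\delta^{-1}\log(\delta^{-1}).$$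
   Context: For $\varrho>0$ let $\Pi(\varrho)=\{z\in\mathbb{C}:|\operatorname{Im}z|<\varrho\}$. $\mathcal{P}_0(\varrho)$ is the set of continuous functions $b:\overline{\Pi(\varrho)^2}\to\mathbb{C}$ that are holomorphic on $\Pi(\varrho)^2$, $2\pi$-periodic in both variables, satisfy $b(\mathbb{R}^2)\subset\mathbb{R}$, and have zero average: $\frac{1}{(2\pi)^2}\iint_{[0,2\pi)^2}b(x,y)\,dx\,dy=0$. It is equipped with the supremum norm $\|\cdot\|_\varrho$ on $\overline{\Pi(\varrho)^2}$. For irrational $\omega\in(0,1)$ with continued fraction expansion $\omega=[a_1,a_2,\ldots]$ (partial quotients $a_j\geqslant1$), $p_n/q_n$ denotes its $n$-th convergent (reduced fraction, obtained by truncating the expansion at $a_n$). For $\Delta>0$ define $$\mathfrak{Brj}_1(\Delta)=\sum_{n=1}^\infty e^{-q_n\Delta}q_{n+1},\quad \mathfrak{Brj}_2(\Delta)=\sum_{n=1}^\infty e^{-q_n\Delta}q_{n+1}\log a_{n+1},\quad \mathfrak{Brj}(\Delta)=2\,\mathfrak{Brj}_1(\Delta)+\mathfrak{Brj}_2(2\Delta).$$ The number $\omega$ is called $\Delta$-semi-Brjuno if both series $\mathfrak{Brj}_1(\Delta)$ and $\mathfrak{Brj}_2(2\Delta)$ converge. *)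

theory Defs
  imports
    "HOL-Complex_Analysis.Complex_Analysis"
    "HOL-Library.Landau_Symbols"
begin

section \<open>Periodic analytic functions on a complex strip\<close>

definition strip :: "real \<Rightarrow> complex set" where
  "strip \<rho> = {z. \<bar>Im z\<bar> < \<rho>}"

abbreviation strip2 :: "real \<Rightarrow> (complex \<times> complex) set" where
  "strip2 \<rho> \<equiv> strip \<rho> \<times> strip \<rho>"

text \<open>Holomorphy in two variables: the real Frechet derivative exists and is complex linear.\<close>

definition holomorphic2_on :: "(complex \<times> complex \<Rightarrow> complex) \<Rightarrow> (complex \<times> complex) set \<Rightarrow> bool" where
  "holomorphic2_on f S \<longleftrightarrow>
     (\<forall>p\<in>S. \<exists>A B. (f has_derivative (\<lambda>(h, k). A * h + B * k)) (at p within S))"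

definition torus_average :: "(complex \<times> complex \<Rightarrow> complex) \<Rightarrow> complex" where
  "torus_average b =
     (1 / (2 * pi)\<^sup>2) *\<^sub>R
     (LINT p : {0..<2 * pi} \<times> {0..<2 * pi} | (lborel :: (real \<times> real) measure).
        b (complex_of_real (fst p), complex_of_real (snd p)))"

text \<open>Functions on the closed strip are represented by total functions; all conditions
  (and hence equality of two elements) only concern the values on the closed strip.\<close>

definition P0 :: "real \<Rightarrow> (complex \<times> complex \<Rightarrow> complex) set" where
  "P0 \<rho> = {b.
     continuous_on (closure (strip2 \<rho>)) b \<and>
     holomorphic2_on b (strip2 \<rho>) \<and>
     (\<forall>(x, y) \<in> closure (strip2 \<rho>).
        b (x + of_real (2 * pi), y) = b (x, y) \<and> b (x, y + of_real (2 * pi)) = b (x, y)) \<and>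
     (\<forall>x y :: real. b (of_real x, of_real y) \<in> \<real>) \<and>
     torus_average b = 0}"

definition strip_norm :: "real \<Rightarrow> (complex \<times> complex \<Rightarrow> complex) \<Rightarrow> real" where
  "strip_norm \<rho> b = (SUP p \<in> closure (strip2 \<rho>). cmod (b p))"

definition solves_cohomological ::
  "real \<Rightarrow> (complex \<times> complex \<Rightarrow> complex) \<Rightarrow> (complex \<times> complex \<Rightarrow> complex) \<Rightarrow>
   (complex \<times> complex) set \<Rightarrow> bool" where
  "solves_cohomological \<omega> g a S \<longleftrightarrow>
     (\<forall>(x, y) \<in> S. deriv (\<lambda>z. g (z, y)) x + of_real \<omega> * deriv (\<lambda>w. g (x, w)) y = a (x, y))"

section \<open>Continued fractions and semi-Brjuno numbers\<close>

text \<open>For irrational \<open>\<omega>\<close> in \<open>(0,1)\<close>, the expansion \<open>\<omega> = [a\<^sub>1, a\<^sub>2, \<dots>]\<close> is generated by iterating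
  the Gauss map; \<open>partial_quotient \<omega> n\<close> is \<open>a\<^sub>n\<close> for \<open>n \<ge> 1\<close> (its value at \<open>n = 0\<close> is
  not used).\<close>

definition gauss_map :: "real \<Rightarrow> real" where
  "gauss_map x = frac (1 / x)"

definition partial_quotient :: "real \<Rightarrow> nat \<Rightarrow> int" where
  "partial_quotient \<omega> n = \<lfloor>1 / (gauss_map ^^ (n - 1)) \<omega>\<rfloor>"

fun cf_value :: "int list \<Rightarrow> rat" where
  "cf_value [] = 0"
| "cf_value (c # cs) = 1 / (of_int c + cf_value cs)"

definition convergent_of :: "real \<Rightarrow> nat \<Rightarrow> rat" where
  "convergent_of \<omega> n = cf_value (map (partial_quotient \<omega>) [1..<n + 1])"

text \<open>\<open>quotient_of\<close> returns numerator and (positive) denominator in lowest terms.\<close>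

definition conv_denom :: "real \<Rightarrow> nat \<Rightarrow> int" where
  "conv_denom \<omega> n = snd (quotient_of (convergent_of \<omega> n))"

definition brj1_term :: "real \<Rightarrow> real \<Rightarrow> nat \<Rightarrow> real" where
  "brj1_term \<omega> \<Delta> n = exp (- of_int (conv_denom \<omega> n) * \<Delta>) * of_int (conv_denom \<omega> (n + 1))"

definition brj2_term :: "real \<Rightarrow> real \<Rightarrow> nat \<Rightarrow> real" where
  "brj2_term \<omega> \<Delta> n =
     exp (- of_int (conv_denom \<omega> n) * \<Delta>) * of_int (conv_denom \<omega> (n + 1)) *
     ln (of_int (partial_quotient \<omega> (n + 1)))"

text \<open>The series start at \<open>n = 1\<close>, hence the index shift.\<close>

definition Brj1 :: "real \<Rightarrow> real \<Rightarrow> real" where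
  "Brj1 \<omega> \<Delta> = (\<Sum>n. brj1_term \<omega> \<Delta> (Suc n))"

definition Brj2 :: "real \<Rightarrow> real \<Rightarrow> real" where
  "Brj2 \<omega> \<Delta> = (\<Sum>n. brj2_term \<omega> \<Delta> (Suc n))"

definition Brj :: "real \<Rightarrow> real \<Rightarrow> real" where
  "Brj \<omega> \<Delta> = 2 * Brj1 \<omega> \<Delta> + Brj2 \<omega> (2 * \<Delta>)"

definition semi_Brjuno :: "real \<Rightarrow> real \<Rightarrow> bool" where
  "semi_Brjuno \<Delta> \<omega> \<longleftrightarrow>
     summable (\<lambda>n. brj1_term \<omega> \<Delta> (Suc n)) \<and> summable (\<lambda>n. brj2_term \<omega> (2 * \<Delta>) (Suc n))"

end

(* A solution must have the Fourier coefficients a_kl / (i (k + \<omega> l)), and moving the contours of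
   integration to the boundary of the strip gives the bound |a_kl| <= exp (- (|k| + |l|) \<rho>) ||a||.
   So everything reduces to estimating the sum over (k, l) \<noteq> (0, 0) of
   exp (- (|k| + |l|) \<delta>) / |k + \<omega> l|. By Legendre's theorem the terms with |k + \<omega> l| < 1 / (2 |l|)
   have (k, l) = \<plusminus> j (- p_n, q_n). The terms with j = 1 contribute the Brj_1 part, those with
   j >= 2 contribute the Brj_2 part, because then j^2 < a_(n+1) and the harmonic sum over j is at most
   (log a_(n+1)) / 2. The remaining terms have 1 / |k + \<omega> l| <= 2 |l| and there is at most one of them
   for every l unless |k + \<omega> l| >= 1/2; together they are absorbed by the term of order \<delta>^(-2).
   Fourier expansion is obtained from Cauchy's theorem and Chernoff's telescoping argument. *)

theory Submission
  imports Defs "HOL-Real_Asymp.Real_Asymp"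
begin

section \<open>Continued fractions\<close>

text \<open>All estimates are of absolute values, so the constants decide. If |k + \<omega> l| <
  1/2, then |k| + |l| is at least (1 + \<omega>) |l| - 1/2: this is why the Brjuno series are taken
  at (1 + \<omega>) \<delta>, and the lost 1/2 turns into a factor exp (\<delta> / 2). Pairs with l
  > 0 and l < 0 are mirror images, so \<open>Brj\<close> gets the factor 2 exp (\<delta> / 2) = 2 +
  O(\<delta>). The other terms sum up to (1/2 + 4 / (1 + \<omega>)^2) \<delta>^(-2) plus a
  correction of order 1/\<delta>. Because (1 + \<omega>)^2 < 4, that constant lies strictly below 8
  / (1 + \<omega>)^2, and the gap swallows the correction for small \<delta>. Holomorphy is given on
  the open strip only, and the norms live on its closure. Hence contours stay inside and their
  height tends to the boundary, Fourier expansions hold at interior points, and statements about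
  boundary points follow by continuity. The solution loses the width \<delta>, but its series
  converges absolutely up to the boundary of the narrower strip.\<close>

fun cf_num :: "(nat \<Rightarrow> int) \<Rightarrow> nat \<Rightarrow> int" where
  "cf_num a 0 = 0"
| "cf_num a (Suc 0) = 1"
| "cf_num a (Suc (Suc n)) = a (Suc (Suc n)) * cf_num a (Suc n) + cf_num a n"

fun cf_den :: "(nat \<Rightarrow> int) \<Rightarrow> nat \<Rightarrow> int" where
  "cf_den a 0 = 1"
| "cf_den a (Suc 0) = a 1"
| "cf_den a (Suc (Suc n)) = a (Suc (Suc n)) * cf_den a (Suc n) + cf_den a n"

text \<open>The product of the matrices \<open>((0, 1), (1, c))\<close> applied to a column vector.\<close>

fun cf_act :: "int list \<Rightarrow> int \<times> int \<Rightarrow> int \<times> int" where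
  "cf_act [] v = v"
| "cf_act (c # cs) v = (snd (cf_act cs v), c * snd (cf_act cs v) + fst (cf_act cs v))"

lemma cf_act_snoc: "cf_act (cs @ [c]) (u, v) = cf_act cs (v, c * v + u)"
  by (induction cs) auto

text \<open>\<open>cf_value\<close> unfolds a list from its head, while the recurrences of
  \<open>cf_num\<close> and \<open>cf_den\<close> extend it at its end. With an arbitrary column (u,
  v), a new last quotient c merely replaces (u, v) by (v, c v + u), so induction on the length
  works.\<close>

lemma cf_act_map:
  "cf_act (map a [1..<Suc m + 1]) (u, v) =
     (cf_num a (Suc m) * v + cf_num a m * u, cf_den a (Suc m) * v + cf_den a m * u)"
proof (induction m arbitrary: u v)
  case 0
  then show ?case by simp
next
  case (Suc m)
  have *: "map a [1..<Suc (Suc m) + 1] = map a [1..<Suc m + 1] @ [a (Suc (Suc m))]"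
    by simp
  show ?case
    unfolding * cf_act_snoc Suc.IH by (simp add: algebra_simps)
qed

text \<open>The signs are carried along because inverting c + p / q requires c q + p > 0.\<close>

lemma cf_value_act:
  assumes "\<forall>c\<in>set cs. 1 \<le> c"
  shows "0 \<le> fst (cf_act cs (0, 1)) \<and> 0 < snd (cf_act cs (0, 1)) \<and>
    cf_value cs = of_int (fst (cf_act cs (0, 1))) / of_int (snd (cf_act cs (0, 1)))"
  using assms
proof (induction cs)
  case Nil
  then show ?case by simp
next
  case (Cons c cs)
  then have IH: "0 \<le> fst (cf_act cs (0, 1))" "0 < snd (cf_act cs (0, 1))"
    "cf_value cs = of_int (fst (cf_act cs (0, 1))) / of_int (snd (cf_act cs (0, 1)))" "1 \<le> c"
    by auto
  then have "0 < c * snd (cf_act cs (0, 1)) + fst (cf_act cs (0, 1))"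
    by (simp add: add_pos_nonneg)
  moreover have "of_int c + cf_value cs =
      (of_int (c * snd (cf_act cs (0, 1)) + fst (cf_act cs (0, 1))) :: rat) / of_int (snd (cf_act cs (0, 1)))"
    using IH by (simp add: field_simps)
  ultimately show ?case using IH by simp
qed

lemma cf_det: "cf_num a (Suc n) * cf_den a n - cf_num a n * cf_den a (Suc n) = (-1) ^ n"
  by (induction n) (simp_all add: algebra_simps)

lemma cf_value_convergent:
  assumes "\<And>n. 1 \<le> n \<Longrightarrow> 1 \<le> a n"
  shows "0 < cf_den a n \<and> cf_value (map a [1..<n + 1]) = of_int (cf_num a n) / of_int (cf_den a n)"
proof (cases n)
  case 0
  then show ?thesis by simp
next
  case (Suc m)
  have "\<forall>c\<in>set (map a [1..<n + 1]). 1 \<le> c" using assms by auto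
  from cf_value_act[OF this] show ?thesis
    unfolding Suc cf_act_map by simp
qed

text \<open>By the determinant identity a common divisor of numerator and denominator divides a
  unit, so the recurrence already produces reduced fractions.\<close>

lemma snd_quotient_of_convergent:
  assumes "\<And>n. 1 \<le> n \<Longrightarrow> 1 \<le> a n"
  shows "snd (quotient_of (cf_value (map a [1..<n + 1]))) = cf_den a n"
proof -
  have pos: "0 < cf_den a n"
    and eq: "cf_value (map a [1..<n + 1]) = of_int (cf_num a n) / of_int (cf_den a n)"
    using cf_value_convergent[of a, OF assms] by blast+
  have "coprime (cf_num a n) (cf_den a n)"
  proof (rule coprimeI)
    fix d assume "d dvd cf_num a n" "d dvd cf_den a n"
    then have "d dvd (-1) ^ n"
      unfolding cf_det[of a n, symmetric] by (intro dvd_diff dvd_mult dvd_mult2)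
    then show "is_unit d"
      using dvd_trans[of d "(-1) ^ n" 1] by (metis dvd_refl is_unit_power_iff dvd_minus_iff)
  qed
  then show ?thesis
    unfolding eq Fract_of_int_quotient[symmetric] quotient_of_Fract
    using pos by (simp add: normalize_stable)
qed

section \<open>Errors of the convergents and Legendre's theorem\<close>

locale irrational_unit =
  fixes \<omega> :: real
  assumes pos: "0 < \<omega>" and less_one: "\<omega> < 1" and irrational: "\<omega> \<notin> \<rat>"
begin

abbreviation "pq \<equiv> partial_quotient \<omega>"
abbreviation "P \<equiv> cf_num pq"
abbreviation "Q \<equiv> cf_den pq"

text \<open>The tail [a_(n+1), a_(n+2), ...] of the expansion.\<close>

definition rest :: "nat \<Rightarrow> real" where
  "rest n = (gauss_map ^^ n) \<omega>"

definition err :: "nat \<Rightarrow> real" where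
  "err n = of_int (Q n) * \<omega> - of_int (P n)"

lemma rest_bounds: "0 < rest n \<and> rest n < 1 \<and> rest n \<notin> \<rat>"
proof (induction n)
  case 0
  then show ?case using pos less_one irrational by (simp add: rest_def)
next
  case (Suc n)
  have eq: "rest (Suc n) = frac (1 / rest n)" by (simp add: rest_def gauss_map_def)
  have "1 / rest n \<notin> \<rat>"
    using Suc Rats_divide[of 1 "1 / rest n"] by auto
  then have "frac (1 / rest n) \<notin> \<rat>"
    using Rats_add[of "frac (1 / rest n)" "of_int \<lfloor>1 / rest n\<rfloor>"] by (auto simp: frac_def)
  moreover have "frac (1 / rest n) \<noteq> 0" using calculation by (metis Rats_0)
  ultimately show ?case unfolding eq
    using frac_ge_0[of "1 / rest n"] frac_lt_1[of "1 / rest n"] by linarith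
qed

lemma rest_Suc: "rest (Suc n) = 1 / rest n - of_int (pq (Suc n))"
  by (simp add: rest_def gauss_map_def partial_quotient_def frac_def)

lemma pq_ge_1: "1 \<le> n \<Longrightarrow> 1 \<le> pq n"
proof -
  assume "1 \<le> n"
  then obtain m where "n = Suc m" by (metis Suc_le_D One_nat_def)
  moreover have "1 \<le> 1 / rest m" using rest_bounds[of m] by simp
  ultimately show ?thesis by (simp add: partial_quotient_def rest_def le_floor_iff)
qed

lemma Q_pos: "0 < Q n"
  using cf_value_convergent[of pq, OF pq_ge_1] by blast

lemma conv_denom_eq: "conv_denom \<omega> n = Q n"
  unfolding conv_denom_def convergent_of_def by (rule snd_quotient_of_convergent[of pq, OF pq_ge_1])

lemma Q_Suc_Suc_ge: "Q (Suc n) + Q n \<le> Q (Suc (Suc n))"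
  using mult_right_mono[OF pq_ge_1[of "Suc (Suc n)"], of "Q (Suc n)"] Q_pos[of "Suc n"] by simp

lemma Q_mono: "Q n \<le> Q (Suc n)"
proof (cases n)
  case 0
  then show ?thesis using pq_ge_1[of 1] by simp
next
  case (Suc m)
  then show ?thesis using Q_Suc_Suc_ge[of m] Q_pos[of m] by simp
qed

text \<open>Linear growth suffices to find a denominator beyond any given l in Legendre's
  theorem.\<close>

lemma Q_Suc_ge: "int (Suc n) \<le> Q (Suc n)"
proof (induction n)
  case 0
  then show ?case using pq_ge_1[of 1] by simp
next
  case (Suc n)
  then show ?case using Q_Suc_Suc_ge[of n] Q_pos[of n] by linarith
qed

lemma Q_Suc_le: "1 \<le> n \<Longrightarrow> Q (Suc n) \<le> (pq (Suc n) + 1) * Q n"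
  using Q_mono[of "n - 1"] by (cases n) (simp_all add: algebra_simps)

text \<open>The errors inherit the three-term recurrence of \<open>P\<close> and \<open>Q\<close>,
  and the Gauss map step 1 / rest n = a_(n+1) + rest (n+1) reproduces it. As tails lie in (0, 1),
  the errors alternate in sign and shrink.\<close>

lemma err_Suc: "err (Suc n) = - rest (Suc n) * err n"
proof (induction n)
  case 0
  have "rest (Suc 0) = 1 / \<omega> - of_int (pq (Suc 0))"
    using rest_Suc[of 0] by (simp add: rest_def)
  then show ?case using pos by (simp add: err_def field_simps)
next
  case (Suc n)
  have "err (Suc (Suc n)) = of_int (pq (Suc (Suc n))) * err (Suc n) + err n"
    by (simp add: err_def algebra_simps)
  also have "err n = - err (Suc n) / rest (Suc n)"
    using Suc rest_bounds[of "Suc n"] by simp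
  finally show ?case
    unfolding rest_Suc[of "Suc n"] by (simp add: algebra_simps)
qed

text \<open>In terms of errors the determinant identity reads Q (n+1) err n - Q n err (n+1) =
  (-1)^n. Eliminating err (n+1) gives the exact size of err n.\<close>

lemma abs_err: "\<bar>err n\<bar> * (of_int (Q (Suc n)) + rest (Suc n) * of_int (Q n)) = 1"
proof -
  have "of_int (P (Suc n) * Q n - P n * Q (Suc n)) =
      of_int (Q (Suc n)) * err n - of_int (Q n) * err (Suc n)"
    by (simp add: err_def algebra_simps)
  also have "\<dots> = err n * (of_int (Q (Suc n)) + rest (Suc n) * of_int (Q n))"
    unfolding err_Suc by (simp add: algebra_simps)
  finally have eq: "err n * (of_int (Q (Suc n)) + rest (Suc n) * of_int (Q n)) = (-1) ^ n"
    unfolding cf_det by simp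
  have nn: "0 \<le> real_of_int (Q (Suc n)) + rest (Suc n) * of_int (Q n)"
    using Q_pos[of n] Q_pos[of "Suc n"] rest_bounds[of "Suc n"] by simp
  have "\<bar>err n\<bar> * \<bar>of_int (Q (Suc n)) + rest (Suc n) * of_int (Q n)\<bar> = 1"
    unfolding abs_mult[symmetric] eq by simp
  then show ?thesis using nn by simp
qed

lemma abs_err_pos: "0 < \<bar>err n\<bar>"
  using abs_err[of n] by (metis abs_ge_zero less_le mult_zero_left zero_neq_one)

lemma inverse_abs_err_le: "1 / \<bar>err n\<bar> \<le> of_int (Q (Suc n)) + of_int (Q n)"
proof -
  have "1 / \<bar>err n\<bar> = of_int (Q (Suc n)) + rest (Suc n) * of_int (Q n)"
    using abs_err[of n] abs_err_pos[of n] by (simp add: field_simps)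
  also have "\<dots> \<le> of_int (Q (Suc n)) + of_int (Q n)"
    using rest_bounds[of "Suc n"] Q_pos[of n] by (simp add: mult_left_le_one_le)
  finally show ?thesis .
qed

text \<open>Consecutive convergents form a basis of the integer lattice. If (p, l) involves the
  later one, its coordinates have opposite signs, and so have the two errors; nothing cancels, so |l
  \<omega> - p| is at least |err n|, which squeezes a nonzero integer below 1. Otherwise (p, l) is a
  multiple of the earlier convergent; the factor j occurs since (p, l) may be imprimitive.\<close>

lemma legendre:
  fixes l p :: int
  assumes l: "1 \<le> l" and close: "\<bar>of_int l * \<omega> - of_int p\<bar> < 1 / (2 * of_int l)"
  obtains n j where "1 \<le> j" "l = j * Q n" "p = j * P n"
proof -
  \<comment> \<open>The index with Q n \<le> l < Q (n+1); for n = 0 the lower bound is Q 0 =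
    1.\<close>
  define n where "n = (LEAST n. l < Q (Suc n))"
  have "l < Q (Suc (nat l))" using Q_Suc_ge[of "nat l"] l by linarith
  then have up: "l < Q (Suc n)"
    unfolding n_def by (rule LeastI[of "\<lambda>n. l < Q (Suc n)"])
  have low: "Q n \<le> l"
  proof (cases n)
    case 0
    then show ?thesis using l by simp
  next
    case (Suc m)
    then have "\<not> l < Q (Suc m)"
      using not_less_Least[of m "\<lambda>n. l < Q (Suc n)"] unfolding n_def[symmetric] by simp
    then show ?thesis using Suc by simp
  qed
  \<comment> \<open>Coordinates by Cramer's rule; the determinant is 1 or -1 and hence its own
    inverse.\<close>
  define D where "D = P (Suc n) * Q n - P n * Q (Suc n)"
  have D: "D * D = 1" unfolding D_def cf_det by (simp flip: power_mult_distrib)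
  define x where "x = D * (l * P (Suc n) - p * Q (Suc n))"
  define y where "y = D * (p * Q n - l * P n)"
  have "x * Q n + y * Q (Suc n) = D * D * l" "x * P n + y * P (Suc n) = D * D * p"
    unfolding x_def y_def by (simp_all add: D_def algebra_simps)
  then have lxy: "l = x * Q n + y * Q (Suc n)" and pxy: "p = x * P n + y * P (Suc n)"
    using D by simp_all
  show thesis
  proof (cases "y = 0")
    case True
    then have "1 \<le> x" using lxy l Q_pos[of n] by (metis add.right_neutral mult_zero_left
      int_one_le_iff_zero_less zero_less_mult_pos2)
    then show thesis using that[of x n] lxy pxy True by simp
  next
    case False
    have sgn: "x < 0 \<and> 0 < y \<or> 0 < x \<and> y < 0"
    proof -
      have "x < 0" if "0 < y"
      proof (rule ccontr)
        assume "\<not> x < 0"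
        then have "0 \<le> x * Q n" using Q_pos[of n] by simp
        moreover have "1 * Q (Suc n) \<le> y * Q (Suc n)"
          using that Q_pos[of "Suc n"] by (intro mult_right_mono) auto
        ultimately show False using lxy up by linarith
      qed
      moreover have "0 < x" if "y < 0"
      proof (rule ccontr)
        assume "\<not> 0 < x"
        then have "x * Q n \<le> 0" using Q_pos[of n] by (simp add: mult_nonpos_nonneg)
        moreover have "y * Q (Suc n) \<le> 0"
          using that Q_pos[of "Suc n"] by (simp add: mult_nonpos_nonneg)
        ultimately show False using lxy l by linarith
      qed
      ultimately show ?thesis using False by linarith
    qed
    let ?e = "of_int l * \<omega> - of_int p"
    have "?e = of_int x * err n + of_int y * err (Suc n)"
      unfolding lxy pxy err_def by (simp add: algebra_simps)
    also have "\<dots> = (of_int x - rest (Suc n) * of_int y) * err n"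
      unfolding err_Suc by (simp add: algebra_simps)
    finally have e: "\<bar>?e\<bar> = \<bar>of_int x - rest (Suc n) * of_int y\<bar> * \<bar>err n\<bar>"
      by (simp add: abs_mult)
    \<comment> \<open>Opposite signs of x and y and a positive tail: the two parts add up in
      absolute value.\<close>
    have "1 \<le> \<bar>of_int x - rest (Suc n) * of_int y\<bar>"
      using sgn
    proof
      assume *: "x < 0 \<and> 0 < y"
      then have "0 < rest (Suc n) * of_int y" "real_of_int x \<le> -1"
        using rest_bounds[of "Suc n"] by simp_all
      then show ?thesis by linarith
    next
      assume *: "0 < x \<and> y < 0"
      then have "rest (Suc n) * of_int y < 0" "1 \<le> real_of_int x"
        using rest_bounds[of "Suc n"] by (simp_all add: mult_pos_neg)
      then show ?thesis by linarith
    qed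
    then have err_le: "\<bar>err n\<bar> \<le> \<bar>?e\<bar>"
      unfolding e using mult_right_mono[of 1 _ "\<bar>err n\<bar>"] by simp
    \<comment> \<open>Up to sign this integer is y. Expressed through both errors it is at most 2 l
      |l \<omega> - p| < 1, a contradiction.\<close>
    have "p * Q n - l * P n \<noteq> 0" using False y_def by auto
    then have "1 \<le> \<bar>p * Q n - l * P n\<bar>" by linarith
    then have "1 \<le> \<bar>real_of_int (p * Q n - l * P n)\<bar>"
      by (metis of_int_1_le_iff of_int_abs)
    also have "real_of_int (p * Q n - l * P n) = - of_int (Q n) * ?e + of_int l * err n"
      by (simp add: err_def algebra_simps)
    also have "\<bar>\<dots>\<bar> \<le> of_int (Q n) * \<bar>?e\<bar> + of_int l * \<bar>err n\<bar>"
      using l Q_pos[of n] abs_triangle_ineq[of "- of_int (Q n) * ?e" "of_int l * err n"]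
      by (simp add: abs_mult)
    also have "\<dots> \<le> of_int l * \<bar>?e\<bar> + of_int l * \<bar>?e\<bar>"
      using l low err_le by (intro add_mono mult_mono) auto
    also have "\<dots> < 1" using close l by (simp add: field_simps)
    finally show thesis by simp
  qed
qed

end

section \<open>Sums with small divisors\<close>

lemma sum_le_suminf_int:
  fixes f :: "nat \<Rightarrow> real"
  assumes "summable f" "\<And>n. 0 \<le> f n" "finite J" "\<And>j. j \<in> J \<Longrightarrow> (0::int) \<le> j"
  shows "(\<Sum>j\<in>J. f (nat j)) \<le> suminf f"
proof -
  have "inj_on nat J" using assms(4) by (auto simp: inj_on_def intro: eq_nat_nat_iff[THEN iffD1])
  then have "(\<Sum>j\<in>J. f (nat j)) = (\<Sum>n\<in>nat ` J. f n)"
    by (simp add: sum.reindex)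
  also have "\<dots> \<le> suminf f"
    using assms by (intro sum_le_suminf) auto
  finally show ?thesis .
qed

text \<open>The loss is only the summand 1 in 1/\<Delta> + 1, so the sums below keep their leading
  coefficients as \<Delta> tends to 0; the coefficient of \<delta>^(-2) depends on this.\<close>

lemma inverse_one_minus_exp_le:
  fixes \<Delta> :: real
  assumes "0 < \<Delta>"
  shows "1 / (1 - exp (- \<Delta>)) \<le> (1 + \<Delta>) / \<Delta>"
proof -
  have "exp (- \<Delta>) \<le> 1 / (1 + \<Delta>)"
    using exp_ge_add_one_self[of \<Delta>] assms by (simp add: exp_minus field_simps)
  then have "\<Delta> / (1 + \<Delta>) \<le> 1 - exp (- \<Delta>)" using assms by (simp add: field_simps)
  then have "1 / (1 - exp (- \<Delta>)) \<le> 1 / (\<Delta> / (1 + \<Delta>))"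
    using assms by (intro divide_left_mono) auto
  then show ?thesis by simp
qed

lemma sum_exp_le:
  fixes \<Delta> :: real
  assumes "0 < \<Delta>" "finite J" "\<And>j. j \<in> J \<Longrightarrow> (0::int) \<le> j"
  shows "(\<Sum>j\<in>J. exp (- of_int j * \<Delta>)) \<le> (1 + \<Delta>) / \<Delta>"
proof -
  let ?x = "exp (- \<Delta>)"
  have x: "norm ?x < 1" using assms by simp
  have "(\<Sum>j\<in>J. exp (- of_int j * \<Delta>)) = (\<Sum>j\<in>J. ?x ^ nat j)"
    using assms by (intro sum.cong) (auto simp flip: exp_of_nat_mult)
  also have "\<dots> \<le> suminf (\<lambda>n. ?x ^ n)"
    using x assms by (intro sum_le_suminf_int) (auto intro: summable_geometric)
  also have "\<dots> = 1 / (1 - ?x)" using x by (rule suminf_geometric)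
  finally show ?thesis using inverse_one_minus_exp_le[OF assms(1)] by simp
qed

lemma sum_linear_exp_le:
  fixes \<Delta> :: real
  assumes "0 < \<Delta>" "finite J" "\<And>j. j \<in> J \<Longrightarrow> (0::int) \<le> j"
  shows "(\<Sum>j\<in>J. of_int j * exp (- of_int j * \<Delta>)) \<le> ((1 + \<Delta>) / \<Delta>)\<^sup>2"
proof -
  let ?x = "exp (- \<Delta>)"
  have x: "norm ?x < 1" using assms by simp
  note sums = geometric_deriv_sums[OF x]
  have "(\<Sum>j\<in>J. of_int j * exp (- of_int j * \<Delta>)) = (\<Sum>j\<in>J. of_nat (nat j) * ?x ^ nat j)"
    using assms by (intro sum.cong) (auto simp flip: exp_of_nat_mult)
  also have "\<dots> \<le> (\<Sum>j\<in>J. of_nat (Suc (nat j)) * ?x ^ nat j)"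
    by (intro sum_mono mult_right_mono) auto
  also have "\<dots> \<le> suminf (\<lambda>n. of_nat (Suc n) * ?x ^ n)"
    using sums assms by (intro sum_le_suminf_int) (auto simp: sums_iff)
  also have "\<dots> = (1 / (1 - ?x))\<^sup>2" using sums by (simp add: sums_iff power_divide)
  also have "\<dots> \<le> ((1 + \<Delta>) / \<Delta>)\<^sup>2"
    using inverse_one_minus_exp_le[OF assms(1)] assms by (intro power_mono) auto
  finally show ?thesis .
qed

lemma sum_exp_abs_le:
  fixes \<Delta> :: real
  assumes "0 < \<Delta>" "finite J"
  shows "(\<Sum>j\<in>J. exp (- \<bar>of_int (j::int)\<bar> * \<Delta>)) \<le> 2 * ((1 + \<Delta>) / \<Delta>)"
proof -
  have "(\<Sum>j\<in>J. exp (- \<bar>of_int j\<bar> * \<Delta>)) =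
      (\<Sum>j\<in>J \<inter> {0..}. exp (- \<bar>of_int j\<bar> * \<Delta>)) + (\<Sum>j\<in>J - {0..}. exp (- \<bar>of_int j\<bar> * \<Delta>))"
    using assms(2) by (metis sum.Int_Diff)
  also have "(\<Sum>j\<in>J \<inter> {0..}. exp (- \<bar>of_int j\<bar> * \<Delta>)) = (\<Sum>j\<in>J \<inter> {0..}. exp (- of_int j * \<Delta>))"
    by (intro sum.cong) auto
  also have "(\<Sum>j\<in>J - {0..}. exp (- \<bar>of_int j\<bar> * \<Delta>)) =
      (\<Sum>j\<in>uminus ` (J - {0..}). exp (- of_int j * \<Delta>))"
    by (subst sum.reindex) (auto intro!: sum.cong simp: inj_on_def)
  also have "(\<Sum>j\<in>J \<inter> {0..}. exp (- of_int j * \<Delta>)) \<le> (1 + \<Delta>) / \<Delta>"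
    using assms by (intro sum_exp_le) auto
  also have "(\<Sum>j\<in>uminus ` (J - {0..}). exp (- of_int j * \<Delta>)) \<le> (1 + \<Delta>) / \<Delta>"
    using assms by (intro sum_exp_le) auto
  finally show ?thesis by simp
qed

lemma sum_inverse_le_ln: "1 \<le> m \<Longrightarrow> (\<Sum>j = 2..(m::int). 1 / real_of_int j) \<le> ln (of_int m)"
proof (induction m rule: int_ge_induct)
  case base
  then show ?case by simp
next
  case (step m)
  have "{2..m + 1} = insert (m + 1) {2..m}" using step by auto
  then have "(\<Sum>j = 2..m + 1. 1 / real_of_int j) \<le> 1 / of_int (m + 1) + ln (of_int m)"
    using step by simp
  also have "1 / real_of_int (m + 1) \<le> ln (of_int (m + 1)) - ln (of_int m)"
    using ln_diff_le[of "of_int m" "of_int (m + 1)"] step by (simp add: field_simps)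
  finally show ?case by simp
qed

definition decay :: "real \<Rightarrow> int \<times> int \<Rightarrow> real" where
  "decay \<delta> p = exp (- (\<bar>of_int (fst p)\<bar> + \<bar>of_int (snd p)\<bar>) * \<delta>)"

lemma decay_pos [simp]: "0 < decay \<delta> p"
  by (simp add: decay_def)

lemma decay_nonneg [simp]: "0 \<le> decay \<delta> p"
  by (simp add: decay_def)

text \<open>Enclosing F in the product of its projections leaves two one-dimensional sums of size
  about 2/\<delta> each.\<close>

lemma sum_decay_le:
  assumes "0 < \<delta>" "finite F"
  shows "sum (decay \<delta>) F \<le> (2 * ((1 + \<delta>) / \<delta>))\<^sup>2"
proof -
  have "sum (decay \<delta>) F \<le> sum (decay \<delta>) (fst ` F \<times> snd ` F)"
    using assms by (intro sum_mono2) (auto simp: less_imp_le intro: rev_image_eqI)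
  also have "\<dots> = (\<Sum>k\<in>fst ` F. exp (- \<bar>of_int k\<bar> * \<delta>)) * (\<Sum>l\<in>snd ` F. exp (- \<bar>of_int l\<bar> * \<delta>))"
    by (simp add: decay_def sum_product sum.cartesian_product case_prod_beta algebra_simps
        flip: exp_add)
  also have "\<dots> \<le> (2 * ((1 + \<delta>) / \<delta>)) * (2 * ((1 + \<delta>) / \<delta>))"
    using assms by (intro mult_mono sum_exp_abs_le sum_nonneg) auto
  finally show ?thesis by (simp add: power2_eq_square)
qed

section \<open>Splitting the lattice sum by the size of the divisor\<close>

context irrational_unit
begin

definition small_div :: "int \<times> int \<Rightarrow> real" where
  "small_div p = \<bar>of_int (fst p) + \<omega> * of_int (snd p)\<bar>"

lemma small_div_nonneg [simp]: "0 \<le> small_div p"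
  by (simp add: small_div_def)

lemma small_div_minus [simp]: "small_div (- p) = small_div p"
  unfolding small_div_def by (cases p) (simp add: abs_if)

lemma frequency_nonzero:
  fixes k l :: int
  assumes "(k, l) \<noteq> (0, 0)"
  shows "of_int k + \<omega> * of_int l \<noteq> 0"
proof
  assume *: "of_int k + \<omega> * of_int l = 0"
  then have "l \<noteq> 0" using assms by auto
  with * have "\<omega> = - of_int k / of_int l" by (simp add: field_simps)
  then have "\<omega> \<in> \<rat>" by simp
  then show False using irrational by simp
qed

text \<open>Since k is within 1/2 of - \<omega> l, decay in two indices becomes decay in l alone, at
  the rate (1 + \<omega>) \<delta>.\<close>

lemma decay_near_le:
  assumes "0 < \<delta>" "1 \<le> snd p" "small_div p < 1 / 2"
  shows "decay \<delta> p \<le> exp (\<delta> / 2) * exp (- of_int (snd p) * ((1 + \<omega>) * \<delta>))"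
proof -
  have "\<omega> * of_int (snd p) - 1 / 2 \<le> \<bar>of_int (fst p)\<bar>"
    using assms(3) unfolding small_div_def by linarith
  then have "(\<omega> * of_int (snd p) - 1 / 2 + of_int (snd p)) * \<delta>
      \<le> (\<bar>of_int (fst p)\<bar> + \<bar>of_int (snd p)\<bar>) * \<delta>"
    using assms by (intro mult_right_mono) auto
  then show ?thesis
    unfolding decay_def exp_add[symmetric] by (simp add: algebra_simps)
qed

lemma sum_nonresonant_le:
  assumes "0 < \<delta>" "finite F"
    and F: "\<And>p. p \<in> F \<Longrightarrow> 1 \<le> snd p \<and> 1 / (2 * of_int (snd p)) \<le> small_div p \<and> small_div p < 1 / 2"
  shows "(\<Sum>p\<in>F. decay \<delta> p / small_div p) \<le>
    2 * exp (\<delta> / 2) * ((1 + (1 + \<omega>) * \<delta>) / ((1 + \<omega>) * \<delta>))\<^sup>2"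
proof -
  let ?D = "(1 + \<omega>) * \<delta>"
  have D: "0 < ?D" using assms pos by simp
  \<comment> \<open>Two admissible k for the same l would be integers at distance less than
    1.\<close>
  have inj: "inj_on snd F"
  proof (rule inj_onI)
    fix p p' assume *: "p \<in> F" "p' \<in> F" "snd p = snd p'"
    then have "\<bar>real_of_int (fst p) - of_int (fst p')\<bar> < 1"
      using F[of p] F[of p'] unfolding small_div_def by (smt (verit) field_sum_of_halves)
    then show "p = p'" using * by (simp add: prod_eq_iff)
  qed
  have "(\<Sum>p\<in>F. decay \<delta> p / small_div p) \<le>
      (\<Sum>p\<in>F. 2 * exp (\<delta> / 2) * (of_int (snd p) * exp (- of_int (snd p) * ?D)))"
  proof (rule sum_mono)
    fix p assume p: "p \<in> F"
    have "decay \<delta> p / small_div p \<le>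
        (exp (\<delta> / 2) * exp (- of_int (snd p) * ?D)) / (1 / (2 * of_int (snd p)))"
      using F[OF p] by (intro frac_le decay_near_le assms(1)) auto
    then show "decay \<delta> p / small_div p \<le>
        2 * exp (\<delta> / 2) * (of_int (snd p) * exp (- of_int (snd p) * ?D))"
      by (simp add: algebra_simps)
  qed
  also have "\<dots> = 2 * exp (\<delta> / 2) * (\<Sum>l\<in>snd ` F. of_int l * exp (- of_int l * ?D))"
    using inj by (simp add: sum.reindex sum_distrib_left)
  also have "\<dots> \<le> 2 * exp (\<delta> / 2) * ((1 + ?D) / ?D)\<^sup>2"
    using D assms(2) by (intro mult_left_mono sum_linear_exp_le) (auto dest!: F)
  finally show ?thesis .
qed

text \<open>The range of \<open>j\<close> for which \<open>(- j P n, j Q n)\<close> has a divisor smaller than \<open>1 / (2 j Q n)\<close>.\<close>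

definition multiples :: "nat \<Rightarrow> int set" where
  "multiples n = {j. 1 \<le> j \<and> 2 * (of_int j)\<^sup>2 * of_int (Q n) * \<bar>err n\<bar> < 1}"

text \<open>For n \<ge> 1 the right side is at most a_(n+1) / 2 + 1, so only about the square root
  of a_(n+1) many multiples are resonant.\<close>

lemma multiples_sq_less:
  assumes "j \<in> multiples n"
  shows "(of_int j)\<^sup>2 < (of_int (Q (Suc n)) + of_int (Q n)) / (2 * real_of_int (Q n))"
proof -
  have "(of_int j)\<^sup>2 < 1 / \<bar>err n\<bar> / (2 * real_of_int (Q n))"
    using assms abs_err_pos[of n] Q_pos[of n] by (simp add: multiples_def field_simps)
  also have "\<dots> \<le> (of_int (Q (Suc n)) + of_int (Q n)) / (2 * real_of_int (Q n))"
    using inverse_abs_err_le[of n] Q_pos[of n] by (intro divide_right_mono) auto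
  finally show ?thesis .
qed

lemma finite_multiples: "finite (multiples n)"
proof (rule finite_subset)
  show "multiples n \<subseteq> {1..\<lceil>(of_int (Q (Suc n)) + of_int (Q n)) / (2 * real_of_int (Q n))\<rceil>}"
  proof
    fix j assume j: "j \<in> multiples n"
    then have "1 \<le> j" by (simp add: multiples_def)
    then have "real_of_int j \<le> (of_int j)\<^sup>2"
      by (simp add: power2_eq_square)
    then have "real_of_int j \<le> (of_int (Q (Suc n)) + of_int (Q n)) / (2 * real_of_int (Q n))"
      using multiples_sq_less[OF j] by linarith
    also have "\<dots> \<le> of_int \<lceil>(of_int (Q (Suc n)) + of_int (Q n)) / (2 * real_of_int (Q n))\<rceil>"
      by (rule le_of_int_ceiling)
    finally show "j \<in> {1..\<lceil>(of_int (Q (Suc n)) + of_int (Q n)) / (2 * real_of_int (Q n))\<rceil>}"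
      unfolding of_int_le_iff using \<open>1 \<le> j\<close> by simp
  qed
qed simp

text \<open>The divisor of the j-th multiple is j |err n|. For j \<ge> 2 the exponent j q_n is at
  least 2 q_n, which is why the second series is taken at 2 \<Delta>.\<close>

lemma sum_multiples_le:
  assumes "0 < \<Delta>" "1 \<le> n"
  shows "(\<Sum>j\<in>multiples n. exp (- of_int (j * Q n) * \<Delta>) / (of_int j * \<bar>err n\<bar>)) \<le>
    2 * brj1_term \<omega> \<Delta> n + brj2_term \<omega> (2 * \<Delta>) n"
proof -
  let ?f = "\<lambda>j. exp (- of_int (j * Q n) * \<Delta>) / (of_int j * \<bar>err n\<bar>)"
  let ?J = "multiples n \<inter> {2..}"
  have q: "1 \<le> Q n" using Q_pos[of n] by simp
  \<comment> \<open>Replacing q_(n+1) + q_n by 2 q_(n+1) is the origin of the coefficient 2 of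
    \<open>Brj1\<close>. For j \<ge> 2 the same 2 cancels against the 1/2 that the square root puts
    in front of the logarithm.\<close>
  have err_le: "1 / \<bar>err n\<bar> \<le> 2 * of_int (Q (Suc n))"
    using inverse_abs_err_le[of n] Q_mono[of n] by linarith
  have nn: "0 \<le> ?f j" if "1 \<le> j" for j
    using that by simp
  have first: "?f 1 \<le> 2 * brj1_term \<omega> \<Delta> n"
    using mult_left_mono[OF err_le, of "exp (- of_int (Q n) * \<Delta>)"]
    by (simp add: brj1_term_def conv_denom_eq algebra_simps)
  have others: "sum ?f ?J \<le> brj2_term \<omega> (2 * \<Delta>) n"
  proof (cases "?J = {}")
    case True
    have "0 \<le> brj2_term \<omega> (2 * \<Delta>) n"
      using pq_ge_1[of "Suc n"] Q_pos[of "Suc n"] by (simp add: brj2_term_def conv_denom_eq)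
    then show ?thesis using True by simp
  next
    case False
    define m where "m = Max ?J"
    have fin: "finite ?J" using finite_multiples by simp
    then have m: "m \<in> multiples n" "2 \<le> m" using Max_in[OF fin False] by (auto simp: m_def)
    have "(of_int (Q (Suc n)) + of_int (Q n)) / (2 * real_of_int (Q n)) \<le>
        (of_int ((pq (Suc n) + 1) * Q n) + of_int (Q n)) / (2 * real_of_int (Q n))"
      using Q_Suc_le[OF assms(2)] q
      by (intro divide_right_mono add_right_mono iffD2[OF of_int_le_iff]) auto
    also have "\<dots> = (of_int (pq (Suc n)) + 2) / 2"
      using q by (simp add: field_simps)
    finally have m_sq: "(real_of_int m)\<^sup>2 < (of_int (pq (Suc n)) + 2) / 2"
      using multiples_sq_less[OF m(1)] by linarith
    moreover have "4 \<le> (real_of_int m)\<^sup>2"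
      using m(2) power_mono[of 2 "real_of_int m" 2] by simp
    \<comment> \<open>With a for the partial quotient: 4 \<le> m^2 < a/2 + 1 forces a > 6, and then
      a/2 + 1 < a.\<close>
    ultimately have "(real_of_int m)\<^sup>2 \<le> of_int (pq (Suc n))" by argo
    then have "ln ((real_of_int m)\<^sup>2) \<le> ln (of_int (pq (Suc n)))"
      using m(2) by (intro ln_mono) auto
    then have ln_m: "2 * ln (real_of_int m) \<le> ln (of_int (pq (Suc n)))"
      using m by (simp add: ln_realpow)
    have "sum ?f ?J \<le> (\<Sum>j\<in>?J. exp (- of_int (Q n) * (2 * \<Delta>)) * (1 / \<bar>err n\<bar>) * (1 / of_int j))"
    proof (rule sum_mono)
      fix j assume j: "j \<in> ?J"
      have "2 * real_of_int (Q n) * \<Delta> \<le> of_int j * of_int (Q n) * \<Delta>"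
        using j q assms by (intro mult_right_mono) auto
      then have "exp (- of_int (j * Q n) * \<Delta>) \<le> exp (- of_int (Q n) * (2 * \<Delta>))"
        by (simp add: algebra_simps)
      then have "?f j \<le> exp (- of_int (Q n) * (2 * \<Delta>)) / (of_int j * \<bar>err n\<bar>)"
        using j by (intro divide_right_mono) auto
      then show "?f j \<le> exp (- of_int (Q n) * (2 * \<Delta>)) * (1 / \<bar>err n\<bar>) * (1 / of_int j)"
        by (simp add: mult.commute)
    qed
    also have "\<dots> = exp (- of_int (Q n) * (2 * \<Delta>)) * (1 / \<bar>err n\<bar>) * (\<Sum>j\<in>?J. 1 / of_int j)"
      by (simp add: sum_distrib_left)
    also have "\<dots> \<le> exp (- of_int (Q n) * (2 * \<Delta>)) * (2 * of_int (Q (Suc n))) * ln (of_int m)"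
    proof (intro mult_mono mult_left_mono err_le)
      have "(\<Sum>j\<in>?J. 1 / real_of_int j) \<le> (\<Sum>j = 2..m. 1 / real_of_int j)"
        using fin by (intro sum_mono2) (auto simp: m_def)
      also have "\<dots> \<le> ln (of_int m)" using m by (intro sum_inverse_le_ln) simp
      finally show "(\<Sum>j\<in>?J. 1 / real_of_int j) \<le> ln (of_int m)" .
    qed (use Q_pos[of "Suc n"] in \<open>auto intro!: sum_nonneg\<close>)
    also have "\<dots> = exp (- of_int (Q n) * (2 * \<Delta>)) * of_int (Q (Suc n)) * (2 * ln (of_int m))"
      by simp
    also have "\<dots> \<le> exp (- of_int (Q n) * (2 * \<Delta>)) * of_int (Q (Suc n)) * ln (of_int (pq (Suc n)))"
      using ln_m Q_pos[of "Suc n"] by (intro mult_left_mono) auto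
    finally show ?thesis by (simp add: brj2_term_def conv_denom_eq)
  qed
  have "multiples n \<subseteq> insert 1 ?J" by (auto simp: multiples_def)
  then have "sum ?f (multiples n) \<le> sum ?f (insert 1 ?J)"
    using finite_multiples by (intro sum_mono2) (auto intro: nn)
  also have "\<dots> = ?f 1 + sum ?f ?J"
    using finite_multiples by (subst sum.insert) auto
  finally show ?thesis using first others by linarith
qed

text \<open>The denominator q_0 = 1 lies outside the Brjuno series, which start at n = 1. Its error
  is \<omega> itself, so all its multiples together cost only O(1/\<delta>).\<close>

lemma sum_multiples_0_le:
  assumes "0 < \<Delta>"
  shows "(\<Sum>j\<in>multiples 0. exp (- of_int (j * Q 0) * \<Delta>) / (of_int j * \<bar>err 0\<bar>)) \<le>
    (1 + \<Delta>) / \<Delta> / \<omega>"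
proof -
  have "(\<Sum>j\<in>multiples 0. exp (- of_int (j * Q 0) * \<Delta>) / (of_int j * \<bar>err 0\<bar>)) \<le>
      (\<Sum>j\<in>multiples 0. exp (- of_int j * \<Delta>) / \<omega>)"
  proof (rule sum_mono)
    fix j assume "j \<in> multiples 0"
    then have "1 \<le> j" by (simp add: multiples_def)
    then have "\<omega> \<le> of_int j * \<omega>" using pos by simp
    then show "exp (- of_int (j * Q 0) * \<Delta>) / (of_int j * \<bar>err 0\<bar>) \<le> exp (- of_int j * \<Delta>) / \<omega>"
      using pos by (auto simp: err_def intro!: divide_left_mono)
  qed
  also have "\<dots> = (\<Sum>j\<in>multiples 0. exp (- of_int j * \<Delta>)) / \<omega>"
    by (simp add: sum_divide_distrib)
  also have "\<dots> \<le> (1 + \<Delta>) / \<Delta> / \<omega>"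
    using pos assms finite_multiples[of 0]
    by (intro divide_right_mono sum_exp_le) (simp_all add: multiples_def)
  finally show ?thesis .
qed

lemma brj1_term_nonneg: "0 \<le> brj1_term \<omega> \<Delta> n"
  using Q_pos[of "n + 1"] by (simp add: brj1_term_def conv_denom_eq)

lemma brj2_term_nonneg: "0 \<le> brj2_term \<omega> \<Delta> n"
  using Q_pos[of "n + 1"] pq_ge_1[of "n + 1"] by (simp add: brj2_term_def conv_denom_eq)

lemma partial_Brj_le:
  assumes "semi_Brjuno \<Delta> \<omega>"
  shows "(\<Sum>n<N. 2 * brj1_term \<omega> \<Delta> (Suc n) + brj2_term \<omega> (2 * \<Delta>) (Suc n)) \<le> Brj \<omega> \<Delta>"
proof -
  have "(\<Sum>n<N. 2 * brj1_term \<omega> \<Delta> (Suc n) + brj2_term \<omega> (2 * \<Delta>) (Suc n)) =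
      2 * (\<Sum>n<N. brj1_term \<omega> \<Delta> (Suc n)) + (\<Sum>n<N. brj2_term \<omega> (2 * \<Delta>) (Suc n))"
    by (simp add: sum.distrib sum_distrib_left)
  also have "\<dots> \<le> Brj \<omega> \<Delta>"
    unfolding Brj_def Brj1_def Brj2_def
    using assms brj1_term_nonneg brj2_term_nonneg unfolding semi_Brjuno_def
    by (intro add_mono mult_left_mono sum_le_suminf) auto
  finally show ?thesis .
qed

text \<open>The sum over lattice points is passed to the indices (n, j) supplied by Legendre's
  theorem and then taken row by row. All terms are nonnegative, so repetitions and additional
  indices can only increase the bound.\<close>

lemma sum_resonant_le:
  assumes "0 < \<delta>" and brj: "semi_Brjuno ((1 + \<omega>) * \<delta>) \<omega>" and "finite F"
    and F: "\<And>p. p \<in> F \<Longrightarrow> 1 \<le> snd p \<and> small_div p < 1 / (2 * of_int (snd p))"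
  shows "(\<Sum>p\<in>F. decay \<delta> p / small_div p) \<le> exp (\<delta> / 2) *
    ((1 + (1 + \<omega>) * \<delta>) / ((1 + \<omega>) * \<delta>) / \<omega> + Brj \<omega> ((1 + \<omega>) * \<delta>))"
proof -
  define D where "D = (1 + \<omega>) * \<delta>"
  have D: "0 < D" using assms pos by (simp add: D_def)
  define g where "g = (\<lambda>(n, j). (- j * P n, j * Q n))"
  have sd_g: "small_div (g (n, j)) = of_int j * \<bar>err n\<bar>" if "1 \<le> j" for n j
  proof -
    have "small_div (g (n, j)) = \<bar>of_int j * err n\<bar>"
      by (simp add: small_div_def g_def err_def algebra_simps)
    then show ?thesis using that by (simp add: abs_mult)
  qed
  have "F \<subseteq> g ` Sigma UNIV multiples"
  proof
    fix p assume p: "p \<in> F"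
    have "\<bar>of_int (snd p) * \<omega> - of_int (- fst p)\<bar> < 1 / (2 * of_int (snd p))"
      using F[OF p] by (simp add: small_div_def algebra_simps)
    then obtain n j where nj: "1 \<le> j" "snd p = j * Q n" "- fst p = j * P n"
      using legendre F[OF p] by metis
    then have gp: "p = g (n, j)" by (simp add: g_def prod_eq_iff)
    have "of_int j * \<bar>err n\<bar> < 1 / (2 * of_int (j * Q n))"
      using F[OF p] sd_g[OF nj(1)] gp nj(2) by metis
    then have "j \<in> multiples n"
      using nj(1) Q_pos[of n] by (simp add: multiples_def field_simps power2_eq_square)
    then show "p \<in> g ` Sigma UNIV multiples" using gp by blast
  qed
  then obtain C where C: "C \<subseteq> Sigma UNIV multiples" "finite C" "F = g ` C"
    using finite_subset_image[OF \<open>finite F\<close>] by metis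
  \<comment> \<open>Inserting 0 keeps the maximum meaningful for an empty C.\<close>
  define N where "N = Max (insert 0 (fst ` C))"
  have CN: "C \<subseteq> Sigma {..N} multiples"
    using C by (auto simp: N_def intro!: Max_ge) (metis fst_conv image_eqI)
  let ?f = "\<lambda>n j. exp (- of_int (j * Q n) * D) / (of_int j * \<bar>err n\<bar>)"
  have "(\<Sum>p\<in>F. decay \<delta> p / small_div p) \<le> (\<Sum>c\<in>C. decay \<delta> (g c) / small_div (g c))"
    unfolding C(3) using C(2) sum_image_le[of C "\<lambda>p. decay \<delta> p / small_div p" g]
    by (simp add: o_def less_imp_le)
  also have "\<dots> \<le> (\<Sum>(n, j)\<in>C. exp (\<delta> / 2) * ?f n j)"
  proof (rule sum_mono)
    fix c assume c: "c \<in> C"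
    obtain n j where nj: "c = (n, j)" by (cases c)
    have "1 \<le> j" using c C(1) nj by (auto simp: multiples_def)
    have Fc: "g c \<in> F" using c C(3) by simp
    have l: "1 \<le> snd (g c)" using F[OF Fc] by simp
    then have "1 / (2 * real_of_int (snd (g c))) \<le> 1 / 2" by (simp add: field_simps)
    then have "small_div (g c) < 1 / 2" using F[OF Fc] by linarith
    from decay_near_le[OF assms(1) l this]
    have "decay \<delta> (g c) \<le> exp (\<delta> / 2) * exp (- of_int (j * Q n) * D)"
      by (simp add: nj g_def D_def)
    then have "decay \<delta> (g c) / small_div (g c) \<le>
        exp (\<delta> / 2) * exp (- of_int (j * Q n) * D) / small_div (g c)"
      by (intro divide_right_mono) auto
    then show "decay \<delta> (g c) / small_div (g c) \<le> (case c of (n, j) \<Rightarrow> exp (\<delta> / 2) * ?f n j)"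
      using sd_g[OF \<open>1 \<le> j\<close>] by (simp add: nj)
  qed
  also have "\<dots> \<le> (\<Sum>(n, j)\<in>Sigma {..N} multiples. exp (\<delta> / 2) * ?f n j)"
    using CN finite_multiples by (intro sum_mono2) (auto simp: multiples_def)
  also have "\<dots> = exp (\<delta> / 2) * (\<Sum>n\<le>N. \<Sum>j\<in>multiples n. ?f n j)"
    by (subst sum.Sigma[symmetric]) (auto simp: finite_multiples sum_distrib_left)
  also have "(\<Sum>n\<le>N. \<Sum>j\<in>multiples n. ?f n j) \<le> (1 + D) / D / \<omega> + Brj \<omega> D"
  proof -
    have "(\<Sum>n\<le>N. \<Sum>j\<in>multiples n. ?f n j) =
        (\<Sum>j\<in>multiples 0. ?f 0 j) + (\<Sum>n<N. \<Sum>j\<in>multiples (Suc n). ?f (Suc n) j)"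
      by (rule sum.atMost_shift)
    also have "\<dots> \<le> (1 + D) / D / \<omega> +
        (\<Sum>n<N. 2 * brj1_term \<omega> D (Suc n) + brj2_term \<omega> (2 * D) (Suc n))"
      by (intro add_mono sum_mono sum_multiples_0_le sum_multiples_le D) auto
    also have "\<dots> \<le> (1 + D) / D / \<omega> + Brj \<omega> D"
      using partial_Brj_le[OF brj] by (simp add: D_def)
    finally show ?thesis .
  qed
  finally show ?thesis by (simp add: D_def)
qed

text \<open>The cutoff 8 trades \<delta>^(-2) against 1/\<delta>: above it the entire lattice sum,
  about 4 \<delta>^(-2), is divided by 8; below it each l admits boundedly many k. The resulting 1/2
  has to stay below 4 / (1 + \<omega>)^2, which exceeds 1.\<close>

lemma sum_far_le:
  assumes "0 < \<delta>" "finite F" and F: "\<And>p. p \<in> F \<Longrightarrow> 1 / 2 \<le> small_div p"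
  shows "(\<Sum>p\<in>F. decay \<delta> p / small_div p) \<le>
    (2 * ((1 + \<delta>) / \<delta>))\<^sup>2 / 8 + 72 * ((1 + \<delta>) / \<delta>)"
proof -
  let ?A = "{p \<in> F. 8 \<le> small_div p}" and ?B = "{p \<in> F. small_div p < 8}"
  have "(\<Sum>p\<in>F. decay \<delta> p / small_div p) =
      (\<Sum>p\<in>?A. decay \<delta> p / small_div p) + (\<Sum>p\<in>?B. decay \<delta> p / small_div p)"
    using assms(2) by (subst sum.union_disjoint[symmetric]) (auto intro!: sum.cong)
  also have "(\<Sum>p\<in>?A. decay \<delta> p / small_div p) \<le> (\<Sum>p\<in>?A. decay \<delta> p / 8)"
    by (intro sum_mono divide_left_mono) (auto simp: less_imp_le)
  also have "\<dots> \<le> (2 * ((1 + \<delta>) / \<delta>))\<^sup>2 / 8"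
    unfolding sum_divide_distrib[symmetric]
    using assms by (intro divide_right_mono sum_decay_le) auto
  also have "(\<Sum>p\<in>?B. decay \<delta> p / small_div p) \<le> (\<Sum>p\<in>?B. 2 * exp (- \<bar>of_int (snd p)\<bar> * \<delta>))"
  proof (rule sum_mono)
    fix p assume p: "p \<in> ?B"
    have "decay \<delta> p / small_div p \<le> exp (- \<bar>of_int (snd p)\<bar> * \<delta>) / (1 / 2)"
      using F[of p] p assms(1) by (intro frac_le) (auto simp: decay_def algebra_simps)
    then show "decay \<delta> p / small_div p \<le> 2 * exp (- \<bar>of_int (snd p)\<bar> * \<delta>)" by simp
  qed
  also have "\<dots> \<le> 72 * ((1 + \<delta>) / \<delta>)"
  proof -
    \<comment> \<open>Shifting k by the integer part of \<omega> l confines it to 18 values that do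
      not depend on l. Hence 72 = 18 * 2 * 2, with one 2 from divisors of at least 1/2 and one from
      the two signs of l.\<close>
    define \<phi> where "\<phi> = (\<lambda>p. (fst p + \<lfloor>\<omega> * of_int (snd p)\<rfloor>, snd p))"
    have inj: "inj_on \<phi> ?B" by (auto simp: inj_on_def \<phi>_def)
    have sub: "\<phi> ` ?B \<subseteq> {-9..8} \<times> snd ` F"
    proof
      fix y assume "y \<in> \<phi> ` ?B"
      then obtain p where p: "p \<in> F" "small_div p < 8" "y = \<phi> p" by auto
      have "real_of_int (fst p + \<lfloor>\<omega> * of_int (snd p)\<rfloor>) < 9"
        "-9 < real_of_int (fst p + \<lfloor>\<omega> * of_int (snd p)\<rfloor>)"
        using p(2) unfolding small_div_def by linarith+
      then show "y \<in> {-9..8} \<times> snd ` F" using p by (auto simp: \<phi>_def)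
    qed
    have "(\<Sum>p\<in>?B. 2 * exp (- \<bar>of_int (snd p)\<bar> * \<delta>)) =
        (\<Sum>y\<in>\<phi> ` ?B. 2 * exp (- \<bar>of_int (snd y)\<bar> * \<delta>))"
      using inj by (simp add: sum.reindex \<phi>_def)
    also have "\<dots> \<le> (\<Sum>y\<in>{-9..8::int} \<times> snd ` F. 2 * exp (- \<bar>of_int (snd y)\<bar> * \<delta>))"
      using sub assms(2) by (intro sum_mono2) auto
    also have "\<dots> = 36 * (\<Sum>l\<in>snd ` F. exp (- \<bar>of_int l\<bar> * \<delta>))"
      by (simp add: sum.cartesian_product' sum_distrib_left case_prod_beta)
    also have "\<dots> \<le> 36 * (2 * ((1 + \<delta>) / \<delta>))"
      using assms by (intro mult_left_mono sum_exp_abs_le) auto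
    finally show ?thesis by simp
  qed
  finally show ?thesis by simp
qed

text \<open>Everything outside the Brjuno part: the far pairs once, and twice, for the two signs of
  l, the row n = 0 and the nonresonant near pairs.\<close>

definition remainder :: "real \<Rightarrow> real" where
  "remainder \<delta> = (2 * ((1 + \<delta>) / \<delta>))\<^sup>2 / 8 + 72 * ((1 + \<delta>) / \<delta>) + 2 * (exp (\<delta> / 2) *
     ((1 + (1 + \<omega>) * \<delta>) / ((1 + \<omega>) * \<delta>) / \<omega> +
      2 * ((1 + (1 + \<omega>) * \<delta>) / ((1 + \<omega>) * \<delta>))\<^sup>2))"

lemma sum_near_le:
  assumes "0 < \<delta>" and brj: "semi_Brjuno ((1 + \<omega>) * \<delta>) \<omega>" and "finite F"
    and F: "\<And>p. p \<in> F \<Longrightarrow> 1 \<le> snd p \<and> small_div p < 1 / 2"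
  shows "(\<Sum>p\<in>F. decay \<delta> p / small_div p) \<le> exp (\<delta> / 2) *
    (Brj \<omega> ((1 + \<omega>) * \<delta>) + (1 + (1 + \<omega>) * \<delta>) / ((1 + \<omega>) * \<delta>) / \<omega> +
      2 * ((1 + (1 + \<omega>) * \<delta>) / ((1 + \<omega>) * \<delta>))\<^sup>2)"
proof -
  let ?A = "{p \<in> F. small_div p < 1 / (2 * of_int (snd p))}"
    and ?B = "{p \<in> F. 1 / (2 * of_int (snd p)) \<le> small_div p}"
  have "(\<Sum>p\<in>F. decay \<delta> p / small_div p) =
      (\<Sum>p\<in>?A. decay \<delta> p / small_div p) + (\<Sum>p\<in>?B. decay \<delta> p / small_div p)"
    using assms(3) by (subst sum.union_disjoint[symmetric]) (auto intro!: sum.cong)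
  also have "(\<Sum>p\<in>?A. decay \<delta> p / small_div p) \<le> exp (\<delta> / 2) *
      ((1 + (1 + \<omega>) * \<delta>) / ((1 + \<omega>) * \<delta>) / \<omega> + Brj \<omega> ((1 + \<omega>) * \<delta>))"
    using assms by (intro sum_resonant_le) auto
  also have "(\<Sum>p\<in>?B. decay \<delta> p / small_div p) \<le>
      2 * exp (\<delta> / 2) * ((1 + (1 + \<omega>) * \<delta>) / ((1 + \<omega>) * \<delta>))\<^sup>2"
    using assms by (intro sum_nonresonant_le) auto
  finally show ?thesis by (simp add: algebra_simps)
qed

text \<open>A divisor below 1/2 excludes l = 0, since k would vanish too. Negation carries the near
  pairs with l < 0 to those with l > 0, which doubles their bound.\<close>

lemma sum_small_div_le:
  assumes "0 < \<delta>" and brj: "semi_Brjuno ((1 + \<omega>) * \<delta>) \<omega>" and "finite F" "(0, 0) \<notin> F"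
  shows "(\<Sum>p\<in>F. decay \<delta> p / small_div p) \<le>
    2 * exp (\<delta> / 2) * Brj \<omega> ((1 + \<omega>) * \<delta>) + remainder \<delta>"
proof -
  let ?f = "\<lambda>p. decay \<delta> p / small_div p"
  let ?A = "{p \<in> F. 1 / 2 \<le> small_div p}"
  let ?B = "{p \<in> F. small_div p < 1 / 2 \<and> 1 \<le> snd p}"
  let ?C = "{p \<in> F. small_div p < 1 / 2 \<and> snd p \<le> -1}"
  have "snd p \<noteq> 0" if "p \<in> F" "small_div p < 1 / 2" for p
  proof
    assume "snd p = 0"
    then have "\<bar>real_of_int (fst p)\<bar> < 1" using that(2) by (simp add: small_div_def)
    then have "fst p = 0" by linarith
    then show False using \<open>snd p = 0\<close> that(1) assms(4) by (metis prod.collapse)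
  qed
  then have "F = (?A \<union> ?B) \<union> ?C" by force
  then have "sum ?f F = sum ?f ((?A \<union> ?B) \<union> ?C)" by simp
  also have "\<dots> = sum ?f (?A \<union> ?B) + sum ?f ?C"
    using assms(3) by (intro sum.union_disjoint) auto
  also have "sum ?f (?A \<union> ?B) = sum ?f ?A + sum ?f ?B"
    using assms(3) by (intro sum.union_disjoint) auto
  also have "sum ?f ?C = sum ?f (uminus ` ?C)"
  proof (subst sum.reindex)
    show "inj_on uminus ?C" by simp
    show "sum ?f ?C = sum (?f \<circ> uminus) ?C"
      by (simp add: decay_def)
  qed
  also have "sum ?f (uminus ` ?C) \<le> exp (\<delta> / 2) *
    (Brj \<omega> ((1 + \<omega>) * \<delta>) + (1 + (1 + \<omega>) * \<delta>) / ((1 + \<omega>) * \<delta>) / \<omega> +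
      2 * ((1 + (1 + \<omega>) * \<delta>) / ((1 + \<omega>) * \<delta>))\<^sup>2)"
  proof (intro sum_near_le assms(1) brj)
    fix p assume "p \<in> uminus ` ?C"
    then obtain r where "r \<in> ?C" "p = - r" by blast
    then show "1 \<le> snd p \<and> small_div p < 1 / 2" by auto
  qed (use assms(3) in auto)
  also have "sum ?f ?B \<le> exp (\<delta> / 2) *
    (Brj \<omega> ((1 + \<omega>) * \<delta>) + (1 + (1 + \<omega>) * \<delta>) / ((1 + \<omega>) * \<delta>) / \<omega> +
      2 * ((1 + (1 + \<omega>) * \<delta>) / ((1 + \<omega>) * \<delta>))\<^sup>2)"
    using assms(3) by (intro sum_near_le assms(1) brj) auto
  also have "sum ?f ?A \<le> (2 * ((1 + \<delta>) / \<delta>))\<^sup>2 / 8 + 72 * ((1 + \<delta>) / \<delta>)"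
    using assms(3) by (intro sum_far_le assms(1)) auto
  finally show ?thesis
    by (simp add: remainder_def algebra_simps)
qed

lemma eventually_remainder_le:
  "\<forall>\<^sub>F \<delta> in at_right 0. \<delta>\<^sup>2 * remainder \<delta> \<le> 8 / (1 + \<omega>)\<^sup>2"
proof -
  \<comment> \<open>This is \<delta>^2 \<open>remainder \<delta>\<close> with the poles cancelled.
    It is continuous at 0, so a strict inequality there persists nearby.\<close>
  define h where "h = (\<lambda>\<delta>. (2 * (1 + \<delta>))\<^sup>2 / 8 + 72 * ((1 + \<delta>) * \<delta>) + 2 * (exp (\<delta> / 2) *
     ((1 + (1 + \<omega>) * \<delta>) * \<delta> / (1 + \<omega>) / \<omega> + 2 * ((1 + (1 + \<omega>) * \<delta>) / (1 + \<omega>))\<^sup>2)))"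
  have "(h \<longlongrightarrow> h 0) (at_right 0)"
    unfolding h_def using pos by (intro tendsto_intros tendsto_eq_intros | simp)+
  moreover have "h 0 < 8 / (1 + \<omega>)\<^sup>2"
  proof -
    define s where "s = (1 + \<omega>)\<^sup>2"
    have "s < 2\<^sup>2" unfolding s_def using pos less_one by (intro power_strict_mono) auto
    moreover have "0 < s" using pos by (simp add: s_def)
    ultimately have "1 / 2 + 4 / s < 8 / s" by (simp add: field_simps)
    moreover have "h 0 = 1 / 2 + 4 / s" by (simp add: h_def s_def power_divide)
    ultimately show ?thesis by (simp add: s_def)
  qed
  ultimately have "\<forall>\<^sub>F \<delta> in at_right 0. h \<delta> < 8 / (1 + \<omega>)\<^sup>2"
    by (rule order_tendstoD)
  moreover have "\<forall>\<^sub>F \<delta> in at_right 0. (0::real) < \<delta>"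
    by (simp add: eventually_at_right_less)
  ultimately show ?thesis
  proof eventually_elim
    case (elim \<delta>)
    have "\<delta>\<^sup>2 * remainder \<delta> = h \<delta>"
      using elim(2) pos by (simp add: remainder_def h_def power_divide divide_simps) algebra
    then show ?case using elim(1) by simp
  qed
qed

end

section \<open>Fourier expansion in a strip\<close>

lemma open_strip: "open (strip R)"
  unfolding strip_def by (intro open_Collect_less continuous_intros)

lemma convex_strip: "convex (strip R)"
proof -
  have "strip R = {z. Im z < R} \<inter> {z. - R < Im z}" by (auto simp: strip_def)
  then show ?thesis
    by (simp add: convex_Int convex_halfspace_Im_lt convex_halfspace_Im_gt)
qed

lemma add_real_in_strip [simp]: "z + of_real x \<in> strip R \<longleftrightarrow> z \<in> strip R"
  by (simp add: strip_def)

lemma segment_in_strip: "\<bar>\<sigma>\<bar> < R \<Longrightarrow> closed_segment (\<i> * of_real \<sigma>) (\<i> * of_real \<sigma> + of_real x) \<subseteq> strip R"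
  by (intro closed_segment_subset convex_strip) (auto simp: strip_def)

definition periodic_strip :: "real \<Rightarrow> (complex \<Rightarrow> complex) \<Rightarrow> bool" where
  "periodic_strip R f \<longleftrightarrow> f holomorphic_on strip R \<and> (\<forall>z\<in>strip R. f (z + of_real (2 * pi)) = f z)"

lemma periodic_strip_int:
  assumes "periodic_strip R f" "z \<in> strip R"
  shows "f (z + of_int n * of_real (2 * pi)) = f z"
proof (induction n rule: int_induct[of _ 0])
  case base
  then show ?case by simp
next
  case (step1 i)
  have "z + of_int i * of_real (2 * pi) \<in> strip R"
    using assms(2) by (simp add: strip_def)
  then have "f (z + of_int i * of_real (2 * pi) + of_real (2 * pi)) = f (z + of_int i * of_real (2 * pi))"
    using assms(1) unfolding periodic_strip_def by blast
  then show ?case using step1 by (simp add: algebra_simps)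
next
  case (step2 i)
  have "z + of_int (i - 1) * of_real (2 * pi) \<in> strip R"
    using assms(2) by (simp add: strip_def)
  then have "f (z + of_int (i - 1) * of_real (2 * pi) + of_real (2 * pi)) =
      f (z + of_int (i - 1) * of_real (2 * pi))"
    using assms(1) unfolding periodic_strip_def by blast
  then show ?case using step2 by (simp add: algebra_simps)
qed

lemma exp_int_2pi [simp]: "exp (\<i> * (of_int k * (z + of_real (2 * pi)))) = exp (\<i> * (of_int k * z))"
  unfolding exp_eq by (rule exI[of _ k]) (simp add: algebra_simps)

lemma periodic_strip_exp: "periodic_strip R (\<lambda>z. exp (\<i> * (of_int k * z)))"
  unfolding periodic_strip_def using exp_int_2pi by (auto intro!: holomorphic_intros)

lemma periodic_strip_mult:
  "periodic_strip R f \<Longrightarrow> periodic_strip R g \<Longrightarrow> periodic_strip R (\<lambda>z. f z * g z)"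
  unfolding periodic_strip_def by (auto intro: holomorphic_intros)

text \<open>A primitive G exists on the convex strip. By periodicity G (z + 2 pi) - G z has
  derivative zero, and its constant value is the integral over one period at every height.\<close>

lemma contour_integral_shift:
  assumes F: "periodic_strip R F" and \<sigma>: "\<bar>\<sigma>\<bar> < R"
  shows "contour_integral (linepath 0 (of_real (2 * pi))) F =
    contour_integral (linepath (\<i> * of_real \<sigma>) (\<i> * of_real \<sigma> + of_real (2 * pi))) F"
proof -
  have hol: "F holomorphic_on strip R" using F by (simp add: periodic_strip_def)
  obtain G where G: "\<And>z. z \<in> strip R \<Longrightarrow> (G has_field_derivative F z) (at z within strip R)"
    using holomorphic_convex_primitive'[OF convex_strip open_strip hol] by blast
  then have G': "\<And>z. z \<in> strip R \<Longrightarrow> (G has_field_derivative F z) (at z)"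
    using open_strip by (metis at_within_open)
  have int: "contour_integral (linepath (\<i> * of_real s) (\<i> * of_real s + of_real (2 * pi))) F =
      G (\<i> * of_real s + of_real (2 * pi)) - G (\<i> * of_real s)" if "\<bar>s\<bar> < R" for s
    using contour_integral_primitive[OF G, of "linepath (\<i> * of_real s) (\<i> * of_real s + of_real (2 * pi))"]
      segment_in_strip[OF that, of "2 * pi"]
    by (simp add: contour_integral_unique)
  have "\<exists>c. \<forall>z\<in>strip R. G (z + of_real (2 * pi)) - G z = c"
  proof (rule has_field_derivative_zero_constant[OF convex_strip])
    fix z assume z: "z \<in> strip R"
    have "((\<lambda>z. G (z + of_real (2 * pi)) - G z) has_field_derivative F (z + of_real (2 * pi)) - F z) (at z)"
    proof (rule DERIV_diff[OF _ G'[OF z]])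
      show "((\<lambda>z. G (z + of_real (2 * pi))) has_field_derivative F (z + of_real (2 * pi))) (at z)"
        using G'[of "z + of_real (2 * pi)"] z by (simp add: DERIV_shift del: of_real_mult)
    qed
    then have "((\<lambda>z. G (z + of_real (2 * pi)) - G z) has_field_derivative 0) (at z)"
      using F z by (simp add: periodic_strip_def del: of_real_mult)
    then show "((\<lambda>z. G (z + of_real (2 * pi)) - G z) has_field_derivative 0) (at z within strip R)"
      by (rule has_field_derivative_at_within)
  qed
  then obtain c where c: "\<And>z. z \<in> strip R \<Longrightarrow> G (z + of_real (2 * pi)) - G z = c" by blast
  have "\<i> * of_real s \<in> strip R" if "\<bar>s\<bar> < R" for s using that by (simp add: strip_def)
  then have "contour_integral (linepath (\<i> * of_real s) (\<i> * of_real s + of_real (2 * pi))) F = c"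
    if "\<bar>s\<bar> < R" for s
    using int[OF that] c that by metis
  from this[of 0] this[of \<sigma>] show ?thesis using \<sigma> by simp
qed

definition fourier1 :: "(complex \<Rightarrow> complex) \<Rightarrow> int \<Rightarrow> complex" where
  "fourier1 f k = contour_integral (linepath 0 (of_real (2 * pi)))
     (\<lambda>z. f z * exp (\<i> * (of_int (- k) * z))) / of_real (2 * pi)"

lemma contour_integrable_strip:
  assumes "f holomorphic_on strip R" "\<bar>\<sigma>\<bar> < R"
  shows "f contour_integrable_on linepath (\<i> * of_real \<sigma>) (\<i> * of_real \<sigma> + of_real x)"
  by (intro contour_integrable_continuous_linepath
      continuous_on_subset[OF holomorphic_on_imp_continuous_on[OF assms(1)]] segment_in_strip assms(2))

text \<open>On the line Im z = \<sigma> the factor exp (- i k z) has constant modulus exp (k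
  \<sigma>).\<close>

lemma norm_fourier1_line_le:
  assumes f: "periodic_strip R f" and \<sigma>: "\<bar>\<sigma>\<bar> < R" and "0 \<le> B"
    and B: "\<And>z. Im z = \<sigma> \<Longrightarrow> 0 \<le> Re z \<Longrightarrow> Re z \<le> 2 * pi \<Longrightarrow> cmod (f z) \<le> B"
  shows "cmod (fourier1 f k) \<le> B * exp (of_int k * \<sigma>)"
proof -
  let ?F = "\<lambda>z. f z * exp (\<i> * (of_int (- k) * z))"
  have F: "periodic_strip R ?F"
    by (intro periodic_strip_mult f periodic_strip_exp)
  let ?g = "linepath (\<i> * of_real \<sigma>) (\<i> * of_real \<sigma> + of_real (2 * pi))"
  have "cmod (contour_integral ?g ?F) \<le>
      (B * exp (of_int k * \<sigma>)) * cmod ((\<i> * of_real \<sigma> + of_real (2 * pi)) - \<i> * of_real \<sigma>)"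
  proof (rule contour_integral_bound_linepath)
    show "?F contour_integrable_on ?g"
      using F \<sigma> by (intro contour_integrable_strip) (auto simp: periodic_strip_def)
    fix z assume "z \<in> closed_segment (\<i> * of_real \<sigma>) (\<i> * of_real \<sigma> + of_real (2 * pi))"
    then obtain u where "0 \<le> u" "u \<le> 1" "z = \<i> * of_real \<sigma> + of_real (u * (2 * pi))"
      unfolding in_segment by (auto simp: scaleR_conv_of_real algebra_simps)
    then have "Im z = \<sigma>" "0 \<le> Re z" "Re z \<le> 2 * pi"
      by (auto simp: mult_left_le_one_le)
    then have "cmod (f z) \<le> B" "cmod (exp (\<i> * (of_int (- k) * z))) = exp (of_int k * \<sigma>)"
      using B by (auto simp: norm_exp_eq_Re)
    then show "cmod (?F z) \<le> B * exp (of_int k * \<sigma>)"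
      unfolding norm_mult by (metis mult_right_mono exp_ge_zero)
  qed (use assms in simp)
  then show ?thesis
    unfolding fourier1_def contour_integral_shift[OF F \<sigma>]
    by (simp add: norm_divide field_simps)
qed

text \<open>The contour moves down for k \<ge> 0 and up for k < 0, so the exponent has the
  favourable sign in both cases.\<close>

lemma norm_fourier1_abs_le:
  assumes f: "periodic_strip R f" and \<sigma>: "0 \<le> \<sigma>" "\<sigma> < R" and "0 \<le> B"
    and B: "\<And>z. \<bar>Im z\<bar> = \<sigma> \<Longrightarrow> 0 \<le> Re z \<Longrightarrow> Re z \<le> 2 * pi \<Longrightarrow> cmod (f z) \<le> B"
  shows "cmod (fourier1 f k) \<le> B * exp (- \<bar>of_int k\<bar> * \<sigma>)"
proof (cases "0 \<le> k")
  case True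
  have "cmod (fourier1 f k) \<le> B * exp (of_int k * (- \<sigma>))"
    using assms by (intro norm_fourier1_line_le[OF f]) auto
  then show ?thesis using True by simp
next
  case False
  have "cmod (fourier1 f k) \<le> B * exp (of_int k * \<sigma>)"
    using assms by (intro norm_fourier1_line_le[OF f]) auto
  then show ?thesis using False by simp
qed

text \<open>Contours cannot touch the boundary of the open strip; the rate R is reached by letting
  their height tend to R.\<close>

lemma norm_fourier1_le:
  assumes f: "periodic_strip R f" and "0 < R" and B: "\<And>z. z \<in> strip R \<Longrightarrow> cmod (f z) \<le> B"
  shows "cmod (fourier1 f k) \<le> B * exp (- \<bar>of_int k\<bar> * R)"
proof (rule tendsto_lowerbound)
  show "((\<lambda>\<sigma>. B * exp (- \<bar>of_int k\<bar> * \<sigma>)) \<longlongrightarrow> B * exp (- \<bar>of_int k\<bar> * R)) (at_left R)"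
    by (intro tendsto_intros)
  have "cmod (f 0) \<le> B" using \<open>0 < R\<close> by (intro B) (simp add: strip_def)
  then have "0 \<le> B" using norm_ge_zero order_trans by blast
  then have "cmod (fourier1 f k) \<le> B * exp (- \<bar>of_int k\<bar> * \<sigma>)" if "0 < \<sigma>" "\<sigma> < R" for \<sigma>
    using that by (intro norm_fourier1_abs_le[OF f]) (auto intro!: B simp: strip_def)
  then show "\<forall>\<^sub>F \<sigma> in at_left R. cmod (fourier1 f k) \<le> B * exp (- \<bar>of_int k\<bar> * \<sigma>)"
    using eventually_at_left_real[OF \<open>0 < R\<close>] by (auto elim: eventually_mono)
qed simp

lemma fourier1_one: "fourier1 (\<lambda>z. 1) k = (if k = 0 then 1 else 0)"
proof (cases "k = 0")
  case True
  then show ?thesis by (simp add: fourier1_def)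
next
  case False
  define c where "c = \<i> * complex_of_int (- k)"
  let ?G = "\<lambda>z. exp (c * z) / c"
  have "c \<noteq> 0" using False by (simp add: c_def)
  then have "(?G has_field_derivative exp (c * z)) (at z within UNIV)" for z
    by (auto intro!: derivative_eq_intros)
  from contour_integral_primitive[OF this, of "linepath 0 (of_real (2 * pi))"]
  have "contour_integral (linepath 0 (of_real (2 * pi))) (\<lambda>z. exp (c * z)) =
      ?G (of_real (2 * pi)) - ?G 0"
    by (simp add: contour_integral_unique)
  also have "\<dots> = 0"
    using exp_int_2pi[of "- k" 0] by (simp add: c_def mult.assoc del: exp_int_2pi)
  finally show ?thesis using False by (simp add: fourier1_def c_def mult.assoc)
qed

text \<open>The quotient is holomorphic across the zeros of the denominator, as these are
  the translates of \<open>z\<^sub>0\<close> by periods.\<close>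

lemma periodic_quotient:
  assumes f: "periodic_strip R f" and z0: "z0 \<in> strip R"
  obtains h where "periodic_strip R h"
    "\<And>z. z \<in> strip R \<Longrightarrow> f z - f z0 = (exp (\<i> * z) - exp (\<i> * z0)) * h z"
proof -
  define E where "E = (\<lambda>z. exp (\<i> * z))"
  \<comment> \<open>At the zeros of the denominator the value is the limit of the quotient, the
    ratio of the derivatives.\<close>
  define h where "h z = (if E z = E z0 then deriv f z / (\<i> * E z) else (f z - f z0) / (E z - E z0))" for z
  have hol: "f holomorphic_on strip R" using f by (simp add: periodic_strip_def)
  have holE: "E holomorphic_on S" for S unfolding E_def by (intro holomorphic_intros)
  have E_eq: "\<exists>n. z = w + of_int n * of_real (2 * pi)" if "E z = E w" for z w
  proof -
    obtain n where "\<i> * z = \<i> * w + of_real (of_int (2 * n) * pi) * \<i>"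
      using \<open>E z = E w\<close> unfolding E_def exp_eq by blast
    then have "\<i> * z = \<i> * (w + of_int n * of_real (2 * pi))" by (simp add: algebra_simps)
    then show ?thesis by (metis complex_i_not_zero mult_left_cancel)
  qed
  have f_eq: "f z = f z0" if "E z = E z0" for z
    using E_eq[OF that] periodic_strip_int[OF f z0] by blast
  have E_per: "E (z + of_real (2 * pi)) = E z" for z
    using exp_int_2pi[of 1 z] by (simp add: E_def)
  have "h analytic_on {z1}" if z1: "z1 \<in> strip R" for z1
  proof (cases "E z1 = E z0")
    case False
    have "continuous_on UNIV E" using holE holomorphic_on_imp_continuous_on by blast
    then have op: "open (strip R \<inter> {z. E z \<noteq> E z0})"
      by (intro open_Int open_strip open_Collect_neq continuous_on_const)
    have "(\<lambda>z. (f z - f z0) / (E z - E z0)) holomorphic_on strip R \<inter> {z. E z \<noteq> E z0}"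
      by (intro holomorphic_intros holE holomorphic_on_subset[OF hol]) auto
    then have "h holomorphic_on strip R \<inter> {z. E z \<noteq> E z0}"
      by (rule holomorphic_transform) (simp add: h_def)
    then show ?thesis using op z1 False by (auto simp: analytic_at)
  next
    case True
    \<comment> \<open>Other zeros are at distance at least 2 pi from z1, so radius 1 isolates
      it.\<close>
    define U where "U = ball z1 1 \<inter> strip R"
    have U: "open U" "z1 \<in> U" using z1 by (auto simp: U_def intro: open_strip)
    \<comment> \<open>Dividing numerator and denominator by z - z1 leaves holomorphic functions with
      removable singularities filled in; \<open>e\<close> has no zero in \<open>U\<close> since the
      exponential has nonzero derivative.\<close>
    define p where "p = (\<lambda>z. if z = z1 then deriv f z1 else (f z - f z1) / (z - z1))"
    define e where "e = (\<lambda>z. if z = z1 then deriv E z1 else (E z - E z1) / (z - z1))"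
    have dE: "deriv E z1 = \<i> * E z1"
      unfolding E_def by (intro DERIV_imp_deriv) (auto intro!: derivative_eq_intros)
    have E_neq: "E z \<noteq> E z1" if "z \<in> U" "z \<noteq> z1" for z
    proof
      assume "E z = E z1"
      then obtain n where n: "z = z1 + of_int n * of_real (2 * pi)" using E_eq by blast
      then have "n \<noteq> 0" using that(2) by auto
      have "dist z1 z = \<bar>of_int n\<bar> * (2 * pi)" using n by (simp add: dist_norm norm_mult)
      moreover have "1 * (2 * pi) \<le> \<bar>of_int n\<bar> * (2 * pi)"
        using \<open>n \<noteq> 0\<close> by (intro mult_right_mono) (auto simp: le_less)
      moreover have "dist z1 z < 1" using that(1) by (simp add: U_def)
      ultimately show False using pi_gt3 by linarith
    qed
    have "interior U = U" using U(1) by (rule interior_open)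
    then have "p holomorphic_on U" "e holomorphic_on U"
      unfolding p_def e_def using U
      by (auto intro!: pole_lemma holE holomorphic_on_subset[OF hol] simp: U_def)
    moreover have "e z \<noteq> 0" if "z \<in> U" for z
      using E_neq[OF that] dE by (auto simp: e_def E_def)
    ultimately have "(\<lambda>z. p z / e z) holomorphic_on U"
      by (intro holomorphic_intros) auto
    then have "h holomorphic_on U"
    proof (rule holomorphic_transform)
      fix z assume "z \<in> U"
      then show "p z / e z = h z"
        using E_neq[of z] dE True f_eq[OF True] by (auto simp: p_def e_def h_def)
    qed
    then show ?thesis using U by (auto simp: analytic_at)
  qed
  then have "h holomorphic_on strip R"
    using analytic_imp_holomorphic analytic_on_analytic_at by blast
  moreover have "h (z + of_real (2 * pi)) = h z" if z: "z \<in> strip R" for z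
  proof -
    have "deriv f (z + of_real (2 * pi)) = deriv f z"
    proof -
      have "(f has_field_derivative deriv f (z + of_real (2 * pi))) (at (z + of_real (2 * pi)))"
        using hol z by (intro holomorphic_derivI[OF _ open_strip]) (auto simp del: of_real_mult)
      then have "((\<lambda>w. f (w + of_real (2 * pi))) has_field_derivative deriv f (z + of_real (2 * pi))) (at z)"
        by (simp add: DERIV_shift del: of_real_mult)
      then have "(f has_field_derivative deriv f (z + of_real (2 * pi))) (at z)"
        by (rule has_field_derivative_transform_within_open[OF _ open_strip z])
          (use f in \<open>auto simp: periodic_strip_def\<close>)
      then show ?thesis by (simp add: DERIV_imp_deriv)
    qed
    then show ?thesis
      using f z unfolding periodic_strip_def h_def E_per by (simp del: of_real_mult)
  qed
  ultimately have "periodic_strip R h" by (simp add: periodic_strip_def)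
  moreover have "f z - f z0 = (exp (\<i> * z) - exp (\<i> * z0)) * h z" for z
    using f_eq[of z] by (auto simp: h_def E_def)
  ultimately show thesis by (rule that)
qed

lemma summable_exp_abs:
  fixes \<Delta> :: real
  assumes "0 < \<Delta>"
  shows "(\<lambda>k::int. exp (- \<bar>of_int k\<bar> * \<Delta>)) summable_on UNIV"
  using sum_exp_abs_le[OF assms]
  by (intro nonneg_bdd_above_summable_on bdd_aboveI2[where M = "2 * ((1 + \<Delta>) / \<Delta>)"]) auto

text \<open>Chernoff's argument: with \<open>h\<close> the quotient of \<open>periodic_quotient\<close>, the symmetric partial sums at \<open>z\<^sub>0\<close>
  telescope, and the boundary terms are Fourier coefficients of \<open>h\<close>, which decay exponentially.\<close>

lemma fourier1_telescope:
  assumes f: "periodic_strip R f" and z0: "z0 \<in> strip R" and h: "periodic_strip R h"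
    and fh: "\<And>z. z \<in> strip R \<Longrightarrow> f z - f z0 = (exp (\<i> * z) - exp (\<i> * z0)) * h z"
  shows "fourier1 f k * exp (\<i> * (of_int k * z0)) - (if k = 0 then f z0 else 0) =
    fourier1 h (k - 1) * exp (\<i> * (of_int k * z0)) - fourier1 h k * exp (\<i> * (of_int (k + 1) * z0))"
proof -
  have "0 < R" using z0 by (auto simp: strip_def)
  let ?e = "\<lambda>k z. exp (\<i> * (of_int (- k) * z))"
  let ?I = "contour_integral (linepath 0 (of_real (2 * pi)))"
  have int: "(\<lambda>z. g z * ?e k z) contour_integrable_on linepath 0 (of_real (2 * pi))"
    if "g holomorphic_on strip R" for g k
  proof -
    have "(\<lambda>z. g z * ?e k z) holomorphic_on strip R"
      using that by (intro holomorphic_intros)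
    then show ?thesis
      using contour_integrable_strip[of "\<lambda>z. g z * ?e k z" R 0 "2 * pi"] \<open>0 < R\<close> by simp
  qed
  have hol: "f holomorphic_on strip R" "h holomorphic_on strip R" "(\<lambda>z. 1) holomorphic_on strip R"
    using f h by (auto simp: periodic_strip_def)
  have "?I (\<lambda>z. f z * ?e k z - f z0 * (1 * ?e k z)) =
      ?I (\<lambda>z. h z * ?e (k - 1) z - exp (\<i> * z0) * (h z * ?e k z))"
  proof (rule contour_integral_cong[OF refl])
    fix z :: complex assume "z \<in> path_image (linepath 0 (of_real (2 * pi)))"
    then have "z \<in> strip R" using segment_in_strip[of 0 R "2 * pi"] \<open>0 < R\<close> by auto
    then have "f z * ?e k z - f z0 * (1 * ?e k z) = (exp (\<i> * z) - exp (\<i> * z0)) * h z * ?e k z"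
      using fh[of z] by (simp flip: left_diff_distrib)
    also have "\<dots> = h z * (exp (\<i> * z) * ?e k z) - exp (\<i> * z0) * (h z * ?e k z)"
      by algebra
    \<comment> \<open>The factor exp (i z) lowers the frequency by one; this shift creates the
      telescoping difference.\<close>
    also have "exp (\<i> * z) * ?e k z = ?e (k - 1) z"
      by (simp add: algebra_simps flip: exp_add)
    finally show "f z * ?e k z - f z0 * (1 * ?e k z) =
        h z * ?e (k - 1) z - exp (\<i> * z0) * (h z * ?e k z)" .
  qed
  then have "?I (\<lambda>z. f z * ?e k z) - f z0 * ?I (\<lambda>z. 1 * ?e k z) =
      ?I (\<lambda>z. h z * ?e (k - 1) z) - exp (\<i> * z0) * ?I (\<lambda>z. h z * ?e k z)"
    using int[OF hol(1), of k] int[OF hol(2), of k] int[OF hol(2), of "k - 1"] int[OF hol(3), of k]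
    by (simp add: contour_integral_diff contour_integral_lmul contour_integrable_lmul
        del: mult_1 of_int_minus of_int_diff)
  then have "(?I (\<lambda>z. f z * ?e k z) - f z0 * ?I (\<lambda>z. 1 * ?e k z)) / of_real (2 * pi) =
      (?I (\<lambda>z. h z * ?e (k - 1) z) - exp (\<i> * z0) * ?I (\<lambda>z. h z * ?e k z)) / of_real (2 * pi)"
    by (rule arg_cong)
  then have "fourier1 f k - f z0 * fourier1 (\<lambda>z. 1) k =
      fourier1 h (k - 1) - exp (\<i> * z0) * fourier1 h k"
    unfolding fourier1_def by (simp only: diff_divide_distrib times_divide_eq_right)
  then have "fourier1 f k - (if k = 0 then f z0 else 0) =
      fourier1 h (k - 1) - exp (\<i> * z0) * fourier1 h k"
    unfolding fourier1_one by (auto split: if_splits)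
  then have "(fourier1 f k - (if k = 0 then f z0 else 0)) * exp (\<i> * (of_int k * z0)) =
      (fourier1 h (k - 1) - exp (\<i> * z0) * fourier1 h k) * exp (\<i> * (of_int k * z0))"
    by (rule arg_cong)
  then show ?thesis
    by (simp add: algebra_simps exp_add)
qed

text \<open>Telescoping controls symmetric partial sums only. Absolute summability, from decay at
  rate R against growth at rate |Im z0| < R, makes the unordered sum exist, and the symmetric sums
  then identify its value.\<close>

lemma fourier1_has_sum:
  assumes f: "periodic_strip R f" and B: "\<And>z. z \<in> strip R \<Longrightarrow> cmod (f z) \<le> B" and z0: "z0 \<in> strip R"
  shows "((\<lambda>k. fourier1 f k * exp (\<i> * (of_int k * z0))) has_sum f z0) UNIV"
proof -
  define y where "y = \<bar>Im z0\<bar>"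
  have y: "0 \<le> y" "y < R" using z0 by (auto simp: strip_def y_def)
  let ?t = "\<lambda>k. fourier1 f k * exp (\<i> * (of_int k * z0))"
  have norm_exp: "cmod (exp (\<i> * (of_int k * z0))) \<le> exp (\<bar>of_int k\<bar> * y)" for k
  proof -
    have "- (of_int k * Im z0) \<le> \<bar>of_int k\<bar> * y"
      unfolding y_def by (metis abs_ge_minus_self abs_mult)
    then show ?thesis by (simp add: norm_exp_eq_Re)
  qed
  have "0 \<le> B" using B[OF z0] norm_ge_zero order_trans by blast
  have "(\<lambda>k. norm (?t k)) summable_on UNIV"
  proof (rule Infinite_Sum.abs_summable_on_comparison_test')
    show "(\<lambda>k::int. B * exp (- \<bar>of_int k\<bar> * (R - y))) summable_on UNIV"
      using y by (intro summable_on_cmult_right summable_exp_abs) simp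
    fix k :: int
    have "norm (?t k) \<le> (B * exp (- \<bar>of_int k\<bar> * R)) * exp (\<bar>of_int k\<bar> * y)"
      unfolding norm_mult using y norm_exp
      by (intro mult_mono norm_fourier1_le[OF f _ B]) (auto simp: \<open>0 \<le> B\<close>)
    then show "norm (?t k) \<le> B * exp (- \<bar>of_int k\<bar> * (R - y))"
      by (simp add: algebra_simps flip: exp_add)
  qed
  then have summ: "?t summable_on UNIV" by (rule abs_summable_summable)
  obtain h where h: "periodic_strip R h"
    and fh: "\<And>z. z \<in> strip R \<Longrightarrow> f z - f z0 = (exp (\<i> * z) - exp (\<i> * z0)) * h z"
    using periodic_quotient[OF f z0] by blast
  define d where "d k = fourier1 h k * exp (\<i> * (of_int (k + 1) * z0))" for k
  have step: "?t k = (if k = 0 then f z0 else 0) + (d (k - 1) - d k)" for k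
    using fourier1_telescope[OF f z0 h fh, of k] by (simp add: d_def algebra_simps)
  have partial: "sum ?t {- int N..int N} = f z0 + d (- int N - 1) - d (int N)" for N
  proof (induction N)
    case 0
    then show ?case using step[of 0] by simp
  next
    case (Suc N)
    have "{- int (Suc N)..int (Suc N)} = insert (- int N - 1) (insert (int N + 1) {- int N..int N})"
      by auto
    then have "sum ?t {- int (Suc N)..int (Suc N)} = ?t (- int N - 1) + (?t (int N + 1) + sum ?t {- int N..int N})"
      by simp
    also have "?t (- int N - 1) = d (- int (Suc N) - 1) - d (- int N - 1)"
      unfolding step[of "- int N - 1"] by simp
    also have "?t (int N + 1) = d (int N) - d (int N + 1)"
      unfolding step[of "int N + 1"] by simp
    finally have "sum ?t {- int (Suc N)..int (Suc N)} = f z0 + d (- int (Suc N) - 1) - d (int N + 1)"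
      unfolding Suc by simp
    then show ?case by (simp add: add.commute)
  qed
  \<comment> \<open>No bound for \<open>h\<close> on the whole strip is available, only one on a
    compact period cell. Its coefficients are therefore estimated at a height strictly between |Im
    z0| and R.\<close>
  obtain \<sigma> where \<sigma>: "y < \<sigma>" "\<sigma> < R" using y dense by blast
  define K where "K = cbox (Complex 0 (-\<sigma>)) (Complex (2 * pi) \<sigma>)"
  have "K \<subseteq> strip R" using \<sigma> by (auto simp: K_def strip_def in_cbox_complex_iff)
  then have "continuous_on K h"
    using h holomorphic_on_imp_continuous_on continuous_on_subset unfolding periodic_strip_def by blast
  then have "bounded (h ` K)"
    by (intro compact_imp_bounded compact_continuous_image) (auto simp: K_def)
  then obtain b where b: "0 < b" "\<And>z. z \<in> K \<Longrightarrow> cmod (h z) \<le> b"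
    unfolding bounded_pos by auto
  have d_le: "cmod (d k) \<le> b * exp y * exp (- (\<sigma> - y)) ^ nat \<bar>k\<bar>" for k
  proof -
    have "cmod (d k) \<le> (b * exp (- \<bar>of_int k\<bar> * \<sigma>)) * exp (\<bar>of_int (k + 1)\<bar> * y)"
      unfolding d_def norm_mult using y \<sigma> b norm_exp[of "k + 1"]
      by (intro mult_mono norm_fourier1_abs_le[OF h]) (auto intro!: b simp: K_def in_cbox_complex_iff)
    also have "\<bar>real_of_int (k + 1)\<bar> * y \<le> (\<bar>of_int k\<bar> + 1) * y"
      using y by (intro mult_right_mono) auto
    then have "(b * exp (- \<bar>of_int k\<bar> * \<sigma>)) * exp (\<bar>of_int (k + 1)\<bar> * y) \<le>
        (b * exp (- \<bar>of_int k\<bar> * \<sigma>)) * exp ((\<bar>of_int k\<bar> + 1) * y)"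
      using b by (intro mult_left_mono) auto
    also have "\<dots> = b * exp y * exp (- (\<sigma> - y)) ^ nat \<bar>k\<bar>"
      by (simp add: algebra_simps flip: exp_add exp_of_nat_mult)
    finally show ?thesis .
  qed
  have pow: "(\<lambda>n. b * exp y * exp (- (\<sigma> - y)) ^ n) \<longlonglongrightarrow> 0"
    using \<sigma> by (intro tendsto_mult_right_zero LIMSEQ_power_zero) auto
  have "(\<lambda>N. d (int N)) \<longlonglongrightarrow> 0"
    using d_le[of "int _"] by (intro Lim_null_comparison[OF _ pow]) (auto intro!: always_eventually)
  moreover have "(\<lambda>N. d (- int N - 1)) \<longlonglongrightarrow> 0"
  proof (rule Lim_null_comparison[OF _ LIMSEQ_Suc[OF pow]])
    have "nat \<bar>- int N - 1\<bar> = Suc N" for N by auto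
    then show "\<forall>\<^sub>F N in sequentially. cmod (d (- int N - 1)) \<le> b * exp y * exp (- (\<sigma> - y)) ^ Suc N"
      using d_le[of "- int _ - 1"] by (intro always_eventually allI) metis
  qed
  ultimately have "(\<lambda>N. f z0 + d (- int N - 1) - d (int N)) \<longlonglongrightarrow> f z0 + 0 - 0"
    by (intro tendsto_intros)
  then have lim1: "(\<lambda>N. sum ?t {- int N..int N}) \<longlonglongrightarrow> f z0" by (simp add: partial)
  \<comment> \<open>Every finite set is eventually contained in the symmetric intervals, so the
    unordered sum is also the limit along them.\<close>
  have "filterlim (\<lambda>N. {- int N..int N}) (finite_subsets_at_top UNIV) sequentially"
    unfolding filterlim_finite_subsets_at_top
  proof (intro allI impI)
    fix X :: "int set" assume "finite X \<and> X \<subseteq> UNIV"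
    define m where "m = nat (Max (insert 0 (abs ` X)))"
    have "\<bar>x\<bar> \<le> int m" if "x \<in> X" for x
      using \<open>finite X \<and> X \<subseteq> UNIV\<close> that by (auto simp: m_def intro!: Max_ge)
    then have "X \<subseteq> {- int N..int N}" if "m \<le> N" for N
      using that by (force simp: abs_le_iff)
    then show "\<forall>\<^sub>F N in sequentially. finite {- int N..int N} \<and> X \<subseteq> {- int N..int N} \<and> {- int N..int N} \<subseteq> UNIV"
      by (intro eventually_sequentiallyI[of m]) auto
  qed
  then have lim2: "(\<lambda>N. sum ?t {- int N..int N}) \<longlonglongrightarrow> infsum ?t UNIV"
    using has_sum_infsum[OF summ] unfolding has_sum_def by (rule filterlim_compose[rotated])
  have "infsum ?t UNIV = f z0"
    using lim1 lim2 LIMSEQ_unique by blast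
  then show ?thesis using has_sum_infsum[OF summ] by simp
qed

section \<open>Two variables: Fourier coefficients and their decay\<close>

definition mode :: "int \<times> int \<Rightarrow> complex \<times> complex \<Rightarrow> complex" where
  "mode p x = exp (\<i> * (of_int (fst p) * fst x)) * exp (\<i> * (of_int (snd p) * snd x))"

text \<open>Iterated contour integrals instead of an area integral, so that the contour can be
  shifted in each variable separately.\<close>

definition fourier2 :: "(complex \<times> complex \<Rightarrow> complex) \<Rightarrow> int \<times> int \<Rightarrow> complex" where
  "fourier2 b p = fourier1 (\<lambda>w. fourier1 (\<lambda>z. b (z, w)) (fst p)) (snd p)"

lemma decay_add: "decay \<alpha> p * decay \<beta> p = decay (\<alpha> + \<beta>) p"
  by (simp add: decay_def algebra_simps flip: exp_add)

lemma summable_decay: "0 < \<delta> \<Longrightarrow> decay \<delta> summable_on UNIV"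
  using sum_decay_le[of \<delta>]
  by (intro nonneg_bdd_above_summable_on bdd_aboveI2[where M = "(2 * ((1 + \<delta>) / \<delta>))\<^sup>2"])
    auto

text \<open>With a negative first argument \<open>decay\<close> is the growth exp ((|k| + |l|) R) of
  a mode on the strip of width R. Summability of \<open>cmod (c p) * decay (- R) p\<close> is the
  form in which absolute convergence up to the boundary is expressed from here on.\<close>

lemma norm_mode_le:
  assumes "\<bar>Im (fst x)\<bar> \<le> R" "\<bar>Im (snd x)\<bar> \<le> R"
  shows "cmod (mode p x) \<le> decay (- R) p"
proof -
  have le: "- (of_int k * t) \<le> \<bar>real_of_int k\<bar> * R" if "\<bar>t\<bar> \<le> R" for k t
  proof -
    have "- (of_int k * t) \<le> \<bar>real_of_int k\<bar> * \<bar>t\<bar>"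
      by (metis abs_ge_minus_self abs_mult)
    also have "\<dots> \<le> \<bar>real_of_int k\<bar> * R"
      using that by (intro mult_left_mono) auto
    finally show ?thesis .
  qed
  have "cmod (mode p x) = exp (- (of_int (fst p) * Im (fst x)) + - (of_int (snd p) * Im (snd x)))"
    by (simp add: mode_def norm_mult norm_exp_eq_Re flip: exp_add)
  also have "\<dots> \<le> exp (\<bar>of_int (fst p)\<bar> * R + \<bar>of_int (snd p)\<bar> * R)"
    using add_mono[OF le[OF assms(1)] le[OF assms(2)]] unfolding exp_le_cancel_iff .
  finally show ?thesis by (simp add: decay_def algebra_simps)
qed

lemma open_strip2: "open (strip2 R)"
  by (intro open_Times open_strip)

lemma holomorphic2_on_sections:
  assumes "holomorphic2_on b (strip2 R)"
  shows "y \<in> strip R \<Longrightarrow> (\<lambda>z. b (z, y)) holomorphic_on strip R"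
    and "x \<in> strip R \<Longrightarrow> (\<lambda>w. b (x, w)) holomorphic_on strip R"
proof -
  have D: "\<exists>A B. (b has_derivative (\<lambda>(h, k). A * h + B * k)) (at (x, y))"
    if "x \<in> strip R" "y \<in> strip R" for x y
    using assms that at_within_open[OF _ open_strip2] unfolding holomorphic2_on_def
    by (metis mem_Sigma_iff)
  have "\<exists>A. ((\<lambda>z. b (z, y)) has_field_derivative A) (at x)"
    if xy: "x \<in> strip R" "y \<in> strip R" for x y
  proof -
    obtain A B where AB: "(b has_derivative (\<lambda>(h, k). A * h + B * k)) (at (x, y))"
      using D[OF xy] by blast
    have "((\<lambda>z. (z, y)) has_derivative (\<lambda>h. (h, 0))) (at x)"
      by (intro derivative_intros)
    from has_derivative_compose[OF this AB] show ?thesis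
      by (auto simp: has_field_derivative_def)
  qed
  then show "y \<in> strip R \<Longrightarrow> (\<lambda>z. b (z, y)) holomorphic_on strip R"
    using holomorphic_on_open[OF open_strip] by blast
  have "\<exists>A. ((\<lambda>w. b (x, w)) has_field_derivative A) (at y)"
    if xy: "x \<in> strip R" "y \<in> strip R" for x y
  proof -
    obtain A B where AB: "(b has_derivative (\<lambda>(h, k). A * h + B * k)) (at (x, y))"
      using D[OF xy] by blast
    have "((\<lambda>w. (x, w)) has_derivative (\<lambda>k. (0, k))) (at y)"
      by (intro derivative_intros)
    from has_derivative_compose[OF this AB] show ?thesis
      by (auto simp: has_field_derivative_def)
  qed
  then show "x \<in> strip R \<Longrightarrow> (\<lambda>w. b (x, w)) holomorphic_on strip R"
    using holomorphic_on_open[OF open_strip] by blast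
qed

lemma strip2_subset_closure: "(x, y) \<in> strip R \<times> strip R \<Longrightarrow> (x, y) \<in> closure (strip2 R)"
  by (rule subsetD[OF closure_subset])

lemma P0_sections:
  assumes "b \<in> P0 R"
  shows "y \<in> strip R \<Longrightarrow> periodic_strip R (\<lambda>z. b (z, y))"
    and "x \<in> strip R \<Longrightarrow> periodic_strip R (\<lambda>w. b (x, w))"
proof -
  have hol: "holomorphic2_on b (strip2 R)"
    and per: "\<And>x y. (x, y) \<in> closure (strip2 R) \<Longrightarrow>
      b (x + of_real (2 * pi), y) = b (x, y) \<and> b (x, y + of_real (2 * pi)) = b (x, y)"
    using assms unfolding P0_def by auto
  show "y \<in> strip R \<Longrightarrow> periodic_strip R (\<lambda>z. b (z, y))"
    using holomorphic2_on_sections[OF hol] per[OF strip2_subset_closure]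
    unfolding periodic_strip_def by blast
  show "x \<in> strip R \<Longrightarrow> periodic_strip R (\<lambda>w. b (x, w))"
    using holomorphic2_on_sections[OF hol] per[OF strip2_subset_closure]
    unfolding periodic_strip_def by blast
qed

text \<open>\<open>strip_norm\<close> is a supremum over a noncompact set and controls values only
  once boundedness is known. Periods move points of the open strip into a compact cell; boundary
  points follow by continuity.\<close>

lemma P0_bdd_above:
  assumes b: "b \<in> P0 R"
  shows "bdd_above ((\<lambda>p. cmod (b p)) ` closure (strip2 R))"
proof -
  have cont: "continuous_on (closure (strip2 R)) b" using b unfolding P0_def by blast
  define C where "C = cbox (Complex 0 (- R)) (Complex (2 * pi) R)"
  define K where "K = closure (strip2 R) \<inter> C \<times> C"
  have "compact K"
    unfolding K_def C_def by (intro closed_Int_compact compact_Times compact_cbox closed_closure)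
  then have "bounded (b ` K)"
    using cont by (intro compact_imp_bounded compact_continuous_image)
      (auto simp: K_def intro: continuous_on_subset)
  then obtain B where B: "\<And>p. p \<in> K \<Longrightarrow> cmod (b p) \<le> B"
    unfolding bounded_iff by auto
  have reduce: "\<exists>n. z + of_int n * of_real (2 * pi) \<in> C \<inter> strip R" if "z \<in> strip R" for z
  proof (intro exI)
    define t where "t = Re z / (2 * pi)"
    have "0 \<le> (t - of_int \<lfloor>t\<rfloor>) * (2 * pi)" "(t - of_int \<lfloor>t\<rfloor>) * (2 * pi) \<le> 1 * (2 * pi)"
      by (intro mult_nonneg_nonneg mult_right_mono; use of_int_floor_le[of t] real_of_int_floor_add_one_gt[of t] in simp; linarith)+
    moreover have "(t - of_int \<lfloor>t\<rfloor>) * (2 * pi) = Re z + of_int (- \<lfloor>t\<rfloor>) * (2 * pi)"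
      by (simp add: t_def left_diff_distrib)
    ultimately show "z + of_int (- \<lfloor>t\<rfloor>) * of_real (2 * pi) \<in> C \<inter> strip R"
      using that by (auto simp: C_def in_cbox_complex_iff strip_def)
  qed
  have "cmod (b p) \<le> B" if p_in: "p \<in> strip2 R" for p
  proof -
    obtain x y where p: "p = (x, y)" "x \<in> strip R" "y \<in> strip R" using p_in by auto
    obtain m n where mn: "x + of_int m * of_real (2 * pi) \<in> C \<inter> strip R"
      "y + of_int n * of_real (2 * pi) \<in> C \<inter> strip R"
      using reduce p by meson
    have "b (x + of_int m * of_real (2 * pi), y + of_int n * of_real (2 * pi)) = b p"
      using periodic_strip_int[OF P0_sections(1)[OF b] p(2), of "y + of_int n * of_real (2 * pi)" m]
        periodic_strip_int[OF P0_sections(2)[OF b p(2)] p(3), of n] mn p by simp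
    moreover have "(x + of_int m * of_real (2 * pi), y + of_int n * of_real (2 * pi)) \<in> K"
      using mn strip2_subset_closure by (auto simp: K_def)
    ultimately show ?thesis using B by metis
  qed
  then have "cmod (b p) \<le> B" if "p \<in> closure (strip2 R)" for p
    using that cont by (intro continuous_on_closure_norm_le[of "strip2 R" b B]) auto
  then show ?thesis by (intro bdd_aboveI2)
qed

lemma P0_norm_le:
  assumes "b \<in> P0 R" "p \<in> closure (strip2 R)"
  shows "cmod (b p) \<le> strip_norm R b"
  unfolding strip_norm_def by (rule cSUP_upper[OF assms(2) P0_bdd_above[OF assms(1)]])

lemma continuous_on_contour_integral_param:
  fixes F :: "complex \<Rightarrow> complex \<Rightarrow> complex"
  assumes "continuous_on (S \<times> T) (\<lambda>(z, w). F z w)" "closed_segment a b \<subseteq> T"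
  shows "continuous_on S (\<lambda>z. contour_integral (linepath a b) (F z))"
proof -
  have "continuous_on (S \<times> cbox 0 1) (\<lambda>(z, t). F z (linepath a b t) * (b - a))"
    unfolding case_prod_beta
  proof (intro continuous_intros)
    have "continuous_on (S \<times> cbox 0 1) ((\<lambda>(z, w). F z w) \<circ> (\<lambda>p. (fst p, linepath a b (snd p))))"
    proof (rule continuous_on_compose)
      show "continuous_on (S \<times> cbox 0 1) (\<lambda>p. (fst p, linepath a b (snd p)))"
        unfolding linepath_def by (intro continuous_intros)
      have "linepath a b t \<in> T" if "t \<in> {0..1}" for t
        using assms(2) that linepath_in_path by blast
      then show "continuous_on ((\<lambda>p. (fst p, linepath a b (snd p))) ` (S \<times> cbox 0 1)) (\<lambda>(z, w). F z w)"
        by (intro continuous_on_subset[OF assms(1)]) auto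
    qed
    then show "continuous_on (S \<times> cbox 0 1) (\<lambda>p. F (fst p) (linepath a b (snd p)))"
      by (simp add: o_def case_prod_beta)
  qed
  then have "continuous_on S (\<lambda>z. integral (cbox 0 1) (\<lambda>t. F z (linepath a b t) * (b - a)))"
    by (rule integral_continuous_on_param)
  then show ?thesis
    by (simp add: contour_integral_integral)
qed

text \<open>Morera's theorem: the integral along a triangle is exchanged with the parameter
  integral, and the inner triangle integrals vanish by Cauchy's theorem.\<close>

lemma holomorphic_on_contour_integral_param:
  fixes F :: "complex \<Rightarrow> complex \<Rightarrow> complex"
  assumes F: "continuous_on (S \<times> T) (\<lambda>(z, w). F z w)" and "open S"
    and hol: "\<And>w. w \<in> T \<Longrightarrow> (\<lambda>z. F z w) holomorphic_on S" and T: "closed_segment c d \<subseteq> T"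
  shows "(\<lambda>z. contour_integral (linepath c d) (F z)) holomorphic_on S"
proof (rule analytic_imp_holomorphic, rule Morera_triangle[OF _ \<open>open S\<close>], goal_cases)
  case 1
  show ?case by (rule continuous_on_contour_integral_param[OF F T])
next
  case (2 u v w)
  show ?case
  proof
    assume hull: "convex hull {u, v, w} \<subseteq> S"
    have F': "continuous_on (T \<times> S) (\<lambda>(w, z). F z w)"
      using continuous_on_compose2[OF F continuous_on_swap, of "T \<times> S"]
      by (force simp: case_prod_beta)
    have seg: "closed_segment p q \<subseteq> S" if "p \<in> {u, v, w}" "q \<in> {u, v, w}" for p q
    proof -
      have "closed_segment p q \<subseteq> convex hull {u, v, w}"
        using that by (intro closed_segment_subset_convex_hull) (auto intro: hull_inc)
      then show ?thesis using hull by blast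
    qed
    have swap: "contour_integral (linepath p q) (\<lambda>z. contour_integral (linepath c d) (F z)) =
        contour_integral (linepath c d) (\<lambda>w. contour_integral (linepath p q) (\<lambda>z. F z w))"
      if "p \<in> {u, v, w}" "q \<in> {u, v, w}" for p q
      using T seg[OF that]
      by (intro contour_integral_swap continuous_on_subset[OF F]) auto
    have int: "(\<lambda>w. contour_integral (linepath p q) (\<lambda>z. F z w)) contour_integrable_on linepath c d"
      if "p \<in> {u, v, w}" "q \<in> {u, v, w}" for p q
      using continuous_on_contour_integral_param[OF F' seg[OF that]] T
      by (intro contour_integrable_continuous_linepath) (auto intro: continuous_on_subset)
    have zero: "contour_integral (linepath u v) (\<lambda>z. F z y) + contour_integral (linepath v w) (\<lambda>z. F z y) +
        contour_integral (linepath w u) (\<lambda>z. F z y) = 0" if "y \<in> T" for y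
      using Cauchy_theorem_triangle[OF holomorphic_on_subset[OF hol[OF that] hull]]
      by (rule has_chain_integral_chain_integral3)
    let ?I = "contour_integral (linepath c d)"
    have "?I (\<lambda>y. contour_integral (linepath u v) (\<lambda>z. F z y)) + ?I (\<lambda>y. contour_integral (linepath v w) (\<lambda>z. F z y)) +
        ?I (\<lambda>y. contour_integral (linepath w u) (\<lambda>z. F z y)) =
        ?I (\<lambda>y. contour_integral (linepath u v) (\<lambda>z. F z y) + contour_integral (linepath v w) (\<lambda>z. F z y) +
          contour_integral (linepath w u) (\<lambda>z. F z y))"
      using int by (simp add: contour_integral_add contour_integrable_add)
    also have "\<dots> = ?I (\<lambda>y. 0)"
      using zero T by (intro contour_integral_cong) auto
    finally show "contour_integral (linepath u v) (\<lambda>z. contour_integral (linepath c d) (F z)) +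
        contour_integral (linepath v w) (\<lambda>z. contour_integral (linepath c d) (F z)) +
        contour_integral (linepath w u) (\<lambda>z. contour_integral (linepath c d) (F z)) = 0"
      by (simp add: swap)
  qed
qed

text \<open>Makes the inner coefficient eligible for the second contour shift, in the remaining
  variable.\<close>

lemma periodic_strip_fourier1:
  assumes b: "b \<in> P0 R" and "0 < R"
  shows "periodic_strip R (\<lambda>w. fourier1 (\<lambda>z. b (z, w)) k)"
  unfolding periodic_strip_def
proof
  have "continuous_on (closure (strip2 R)) b" using b unfolding P0_def by blast
  then have cont: "continuous_on (strip R \<times> strip R) b"
    by (rule continuous_on_subset[OF _ closure_subset])
  have "(\<lambda>w. contour_integral (linepath 0 (of_real (2 * pi)))
      (\<lambda>z. b (z, w) * exp (\<i> * (of_int (- k) * z)))) holomorphic_on strip R"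
  proof (rule holomorphic_on_contour_integral_param[where T = "strip R", OF _ open_strip])
    have "continuous_on (strip R \<times> strip R) (\<lambda>p. b (snd p, fst p))"
      by (rule continuous_on_compose2[OF cont, of _ "\<lambda>p. (snd p, fst p)"])
        (auto intro!: continuous_intros)
    then show "continuous_on (strip R \<times> strip R) (\<lambda>(w, z). b (z, w) * exp (\<i> * (of_int (- k) * z)))"
      unfolding case_prod_beta by (intro continuous_intros)
    show "(\<lambda>w. b (z, w) * exp (\<i> * (of_int (- k) * z))) holomorphic_on strip R" if "z \<in> strip R" for z
      using P0_sections(2)[OF b that] unfolding periodic_strip_def by (intro holomorphic_intros) blast
    show "closed_segment 0 (of_real (2 * pi)) \<subseteq> strip R"
      using segment_in_strip[of 0 R "2 * pi"] \<open>0 < R\<close> by simp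
  qed
  then show "(\<lambda>w. fourier1 (\<lambda>z. b (z, w)) k) holomorphic_on strip R"
    unfolding fourier1_def by (intro holomorphic_intros) auto
  show "\<forall>w\<in>strip R. fourier1 (\<lambda>z. b (z, w + of_real (2 * pi))) k = fourier1 (\<lambda>z. b (z, w)) k"
  proof
    fix w assume w: "w \<in> strip R"
    show "fourier1 (\<lambda>z. b (z, w + of_real (2 * pi))) k = fourier1 (\<lambda>z. b (z, w)) k"
      unfolding fourier1_def
    proof (intro arg_cong2[of _ _ _ _ "(/)"] contour_integral_cong refl)
      fix z :: complex assume "z \<in> path_image (linepath 0 (of_real (2 * pi)))"
      then have "z \<in> strip R" using segment_in_strip[of 0 R "2 * pi"] \<open>0 < R\<close> by auto
      then show "b (z, w + of_real (2 * pi)) * exp (\<i> * (of_int (- k) * z)) =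
          b (z, w) * exp (\<i> * (of_int (- k) * z))"
        using P0_sections(2)[OF b] w unfolding periodic_strip_def by auto
    qed
  qed
qed

lemma norm_fourier1_section_le:
  assumes b: "b \<in> P0 R" and "0 < R" and "w \<in> strip R"
  shows "cmod (fourier1 (\<lambda>z. b (z, w)) k) \<le> strip_norm R b * exp (- \<bar>of_int k\<bar> * R)"
proof (rule norm_fourier1_le[OF P0_sections(1)[OF b \<open>w \<in> strip R\<close>] \<open>0 < R\<close>])
  show "cmod (b (z, w)) \<le> strip_norm R b" if "z \<in> strip R" for z
    using that \<open>w \<in> strip R\<close> by (intro P0_norm_le[OF b] strip2_subset_closure SigmaI)
qed

lemma norm_fourier2_le:
  assumes b: "b \<in> P0 R" and "0 < R"
  shows "cmod (fourier2 b p) \<le> strip_norm R b * decay R p"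
proof -
  have "cmod (fourier2 b p) \<le>
      (strip_norm R b * exp (- \<bar>of_int (fst p)\<bar> * R)) * exp (- \<bar>of_int (snd p)\<bar> * R)"
    unfolding fourier2_def
    by (rule norm_fourier1_le[OF periodic_strip_fourier1[OF assms] \<open>0 < R\<close> norm_fourier1_section_le[OF assms]])
  then show ?thesis
    by (simp add: decay_def algebra_simps flip: exp_add)
qed

lemma strip_norm_nonneg:
  assumes "b \<in> P0 R" "0 < R"
  shows "0 \<le> strip_norm R b"
proof -
  have "(0, 0) \<in> closure (strip2 R)"
    using assms by (intro strip2_subset_closure) (simp add: strip_def)
  from order_trans[OF norm_ge_zero P0_norm_le[OF assms(1) this]] show ?thesis .
qed

lemma summable_fourier2:
  assumes b: "b \<in> P0 R" and "0 < R" "r < R"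
  shows "(\<lambda>p. cmod (fourier2 b p) * decay (- r) p) summable_on UNIV"
proof (rule summable_on_comparison_test)
  show "(\<lambda>p. strip_norm R b * decay (R - r) p) summable_on UNIV"
    by (rule summable_on_cmult_right[OF summable_decay]) (simp add: \<open>r < R\<close>)
  show "cmod (fourier2 b p) * decay (- r) p \<le> strip_norm R b * decay (R - r) p" for p
  proof -
    have "cmod (fourier2 b p) * decay (- r) p \<le> (strip_norm R b * decay R p) * decay (- r) p"
      by (rule mult_right_mono[OF norm_fourier2_le[OF b \<open>0 < R\<close>] decay_nonneg])
    then show ?thesis using decay_add[of R p "- r"] by (simp add: mult.assoc)
  qed
qed simp

lemma summable_mode_series:
  assumes "(\<lambda>p. cmod (c p) * decay (- R) p) summable_on UNIV"
    and "\<bar>Im (fst x)\<bar> \<le> R" "\<bar>Im (snd x)\<bar> \<le> R"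
  shows "(\<lambda>p. c p * mode p x) summable_on UNIV"
proof (rule abs_summable_summable, rule Infinite_Sum.abs_summable_on_comparison_test'[OF assms(1)])
  show "norm (c p * mode p x) \<le> cmod (c p) * decay (- R) p" for p
    unfolding norm_mult by (intro mult_left_mono norm_mode_le assms) simp
qed

text \<open>The one-variable expansion is used in w for the coefficients in z and then in z. The
  iterated sums merge into one unordered sum because the double series converges absolutely at
  heights below R.\<close>

lemma fourier2_has_sum:
  assumes b: "b \<in> P0 R" and x: "x \<in> strip2 R"
  shows "((\<lambda>p. fourier2 b p * mode p x) has_sum b x) UNIV"
proof -
  obtain z w where zw: "x = (z, w)" "z \<in> strip R" "w \<in> strip R" using x by auto
  then have "0 < R" by (auto simp: strip_def)
  define r where "r = max \<bar>Im z\<bar> \<bar>Im w\<bar>"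
  have r: "r < R" using zw by (auto simp: strip_def r_def)
  have "((\<lambda>p. fourier2 b p * mode p x) has_sum b x) (Sigma UNIV (\<lambda>_. UNIV))"
  proof (rule has_sum_SigmaI)
    fix k :: int
    have "((\<lambda>l. fourier1 (\<lambda>w. fourier1 (\<lambda>z. b (z, w)) k) l * exp (\<i> * (of_int l * w))) has_sum
        fourier1 (\<lambda>z. b (z, w)) k) UNIV"
      using norm_fourier1_section_le[OF b \<open>0 < R\<close>] zw
      by (intro fourier1_has_sum[OF periodic_strip_fourier1[OF b \<open>0 < R\<close>]]) auto
    from has_sum_cmult_left[OF this, of "exp (\<i> * (of_int k * z))"]
    show "((\<lambda>l. fourier2 b (k, l) * mode (k, l) x) has_sum
        fourier1 (\<lambda>z. b (z, w)) k * exp (\<i> * (of_int k * z))) UNIV"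
      by (simp add: fourier2_def mode_def zw algebra_simps)
  next
    show "((\<lambda>k. fourier1 (\<lambda>z. b (z, w)) k * exp (\<i> * (of_int k * z))) has_sum b x) UNIV"
      unfolding zw(1)
    proof (rule fourier1_has_sum[OF P0_sections(1)[OF b zw(3)] _ zw(2)])
      show "cmod (b (z, w)) \<le> strip_norm R b" if "z \<in> strip R" for z
        using that zw(3) by (intro P0_norm_le[OF b] strip2_subset_closure SigmaI)
    qed
    show "(\<lambda>p. fourier2 b p * mode p x) summable_on UNIV \<times> UNIV"
      using summable_mode_series[OF summable_fourier2[OF b \<open>0 < R\<close> r], of x]
      by (simp add: zw r_def)
  qed
  then show ?thesis by simp
qed

text \<open>Turns unordered sums into ordinary series, the form in which termwise differentiation is
  applied.\<close>

lemma sums_reindex_UNIV: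
  fixes f :: "'a \<Rightarrow> 'b::banach"
  assumes e: "bij_betw e (UNIV :: nat set) (UNIV :: 'a set)" and f: "f summable_on UNIV"
  shows "(\<lambda>n. f (e n)) sums infsum f UNIV"
  using has_sum_infsum[OF f] has_sum_reindex_bij_betw[OF e, of f "infsum f UNIV"]
  by (intro has_sum_imp_sums) simp

section \<open>Functions defined by Fourier series: differentiation and continuity\<close>

definition mode_series :: "(int \<times> int \<Rightarrow> complex) \<Rightarrow> complex \<times> complex \<Rightarrow> complex" where
  "mode_series c x = (\<Sum>\<^sub>\<infinity>p. c p * mode p x)"

lemma mode_has_derivative:
  "(mode p has_derivative (\<lambda>(h, k). (\<i> * of_int (fst p) * mode p x) * h + (\<i> * of_int (snd p) * mode p x) * k)) (at x within S)"
proof -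
  have D: "((\<lambda>x. exp (g x)) has_derivative (\<lambda>v. exp (g x) * g' v)) (at x within S)"
    if "(g has_derivative g') (at x within S)" for g g' :: "complex \<times> complex \<Rightarrow> complex"
    by (rule has_derivative_compose[OF that DERIV_exp[unfolded has_field_derivative_def]])
  show ?thesis
    unfolding mode_def
    by (rule has_derivative_eq_rhs[OF has_derivative_mult[OF D D]], (rule derivative_eq_intros refl)+)
      (auto simp: fun_eq_iff algebra_simps)
qed

text \<open>By t \<le> exp t with t = (R - r) (|k| + |l|), a factor k or l costs the constant 1 / (R
  - r) and an arbitrarily small loss of width.\<close>

lemma abs_summable_frequency:
  assumes c: "(\<lambda>p. cmod (c p) * decay (- R) p) summable_on UNIV" and "r < R"
  shows "(\<lambda>p. cmod (c p * of_int (fst p)) * decay (- r) p) summable_on UNIV"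
    and "(\<lambda>p. cmod (c p * of_int (snd p)) * decay (- r) p) summable_on UNIV"
proof -
  have *: "(\<lambda>p. 1 / (R - r) * (cmod (c p) * decay (- R) p)) summable_on UNIV"
    by (rule summable_on_cmult_right[OF c])
  have le: "cmod (c p * of_int m) * decay (- r) p \<le> 1 / (R - r) * (cmod (c p) * decay (- R) p)"
    if m: "\<bar>of_int m\<bar> \<le> \<bar>of_int (fst p)\<bar> + \<bar>of_int (snd p) :: real\<bar>" for p m
  proof -
    let ?t = "\<bar>of_int (fst p)\<bar> + \<bar>of_int (snd p) :: real\<bar>"
    have "(R - r) * \<bar>of_int m\<bar> \<le> (R - r) * ?t" using m \<open>r < R\<close> by (intro mult_left_mono) auto
    also have "\<dots> \<le> exp ((R - r) * ?t)" using exp_ge_add_one_self[of "(R - r) * ?t"] by linarith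
    also have "\<dots> = decay (r - R) p" by (simp add: decay_def algebra_simps)
    finally have "\<bar>of_int m\<bar> \<le> 1 / (R - r) * decay (r - R) p"
      using \<open>r < R\<close> by (simp add: field_simps)
    then have "cmod (c p) * \<bar>of_int m\<bar> * decay (- r) p \<le>
        cmod (c p) * (1 / (R - r) * decay (r - R) p) * decay (- r) p"
      by (intro mult_right_mono mult_left_mono) auto
    also have "\<dots> = 1 / (R - r) * (cmod (c p) * decay (- R) p)"
      using decay_add[of "r - R" p "- r"] by (simp add: mult.assoc)
    finally show ?thesis by (simp add: norm_mult)
  qed
  show "(\<lambda>p. cmod (c p * of_int (fst p)) * decay (- r) p) summable_on UNIV"
    by (rule summable_on_comparison_test[OF *]) (rule le, auto)
  show "(\<lambda>p. cmod (c p * of_int (snd p)) * decay (- r) p) summable_on UNIV"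
    by (rule summable_on_comparison_test[OF *]) (rule le, auto)
qed

lemma norm_term_le:
  assumes "\<bar>Im (fst x)\<bar> \<le> R" "\<bar>Im (snd x)\<bar> \<le> R"
  shows "norm (c p * mode p x) \<le> cmod (c p) * decay (- R) p"
  unfolding norm_mult by (intro mult_left_mono norm_mode_le assms) simp

text \<open>On a narrower strip around the point the series of both partial derivatives converge
  uniformly, so differentiation is termwise there; being a derivative is a local matter.\<close>

lemma mode_series_has_derivative:
  assumes c: "(\<lambda>p. cmod (c p) * decay (- R) p) summable_on UNIV" and x: "x \<in> strip2 R"
  shows "(mode_series c has_derivative
    (\<lambda>(h, k). mode_series (\<lambda>p. \<i> * (c p * of_int (fst p))) x * h +
      mode_series (\<lambda>p. \<i> * (c p * of_int (snd p))) x * k)) (at x)"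
proof -
  define r0 where "r0 = max \<bar>Im (fst x)\<bar> \<bar>Im (snd x)\<bar>"
  have "r0 < R" using x by (auto simp: strip_def r0_def)
  then obtain r where r: "r0 < r" "r < R" using dense by blast
  define S where "S = strip2 r"
  have xS: "x \<in> S" using r by (cases x) (auto simp: S_def strip_def r0_def)
  have oS: "open S" unfolding S_def by (rule open_strip2)
  have S_Im: "\<bar>Im (fst y)\<bar> \<le> r" "\<bar>Im (snd y)\<bar> \<le> r" if "y \<in> S" for y
    using that by (auto simp: S_def strip_def)
  define e where "e = from_nat_into (UNIV :: (int \<times> int) set)"
  have e: "bij_betw e UNIV UNIV"
    unfolding e_def by (rule bij_betw_from_nat_into) (auto simp: finite_prod)
  define A where "A = (\<lambda>p. \<i> * (c p * of_int (fst p)))"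
  define B where "B = (\<lambda>p. \<i> * (c p * of_int (snd p)))"
  have sA: "(\<lambda>p. cmod (A p) * decay (- r) p) summable_on UNIV"
    and sB: "(\<lambda>p. cmod (B p) * decay (- r) p) summable_on UNIV"
    using abs_summable_frequency[OF c r(2)] by (simp_all add: A_def B_def norm_mult)
  have unif: "uniform_limit S (\<lambda>N y. \<Sum>n<N. d (e n) * mode (e n) y) (mode_series d) sequentially"
    if d: "(\<lambda>p. cmod (d p) * decay (- r) p) summable_on UNIV" for d
  proof -
    have "uniform_limit S (\<lambda>N y. \<Sum>n<N. d (e n) * mode (e n) y) (\<lambda>y. \<Sum>n. d (e n) * mode (e n) y) sequentially"
    proof (rule Weierstrass_m_test)
      show "norm (d (e n) * mode (e n) y) \<le> cmod (d (e n)) * decay (- r) (e n)" if "y \<in> S" for n y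
        by (rule norm_term_le[OF S_Im[OF that]])
      show "summable (\<lambda>n. cmod (d (e n)) * decay (- r) (e n))"
        using sums_reindex_UNIV[OF e d] by (simp add: sums_iff)
    qed
    moreover have "(\<Sum>n. d (e n) * mode (e n) y) = mode_series d y" if "y \<in> S" for y
      using sums_reindex_UNIV[OF e summable_mode_series[OF d S_Im[OF that]]]
      by (simp add: sums_iff mode_series_def)
    ultimately show ?thesis
      by (subst uniform_limit_cong'[OF refl, of _ _ "\<lambda>y. \<Sum>n. d (e n) * mode (e n) y"]) auto
  qed
  have "\<exists>g. \<forall>y\<in>S. (\<lambda>n. c (e n) * mode (e n) y) sums g y \<and>
      (g has_derivative (\<lambda>(h, k). mode_series A y * h + mode_series B y * k)) (at y within S)"
  proof (rule has_derivative_series[where x = x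
        and f' = "\<lambda>n y (h, k). (A (e n) * mode (e n) y) * h + (B (e n) * mode (e n) y) * k"])
    show "convex S" unfolding S_def by (intro convex_Times convex_strip)
    show "x \<in> S" by (rule xS)
    show "((\<lambda>y. c (e n) * mode (e n) y) has_derivative
        (\<lambda>(h, k). (A (e n) * mode (e n) y) * h + (B (e n) * mode (e n) y) * k)) (at y within S)" for n y
      by (rule has_derivative_eq_rhs[OF has_derivative_mult_right[OF mode_has_derivative]])
        (auto simp: A_def B_def algebra_simps)
    have "r0 \<le> R" "\<bar>Im (fst x)\<bar> \<le> r0" "\<bar>Im (snd x)\<bar> \<le> r0" using \<open>r0 < R\<close> by (auto simp: r0_def)
    then show "(\<lambda>n. c (e n) * mode (e n) x) sums mode_series c x"
      unfolding mode_series_def by (intro sums_reindex_UNIV e summable_mode_series[OF c]) auto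
    fix \<epsilon> :: real assume "0 < \<epsilon>"
    \<comment> \<open>Half of \<epsilon> for each partial derivative, since each component of a
      vector is bounded by its norm.\<close>
    have "\<forall>\<^sub>F n in sequentially. \<forall>y\<in>S. dist (\<Sum>i<n. A (e i) * mode (e i) y) (mode_series A y) < \<epsilon> / 2"
      "\<forall>\<^sub>F n in sequentially. \<forall>y\<in>S. dist (\<Sum>i<n. B (e i) * mode (e i) y) (mode_series B y) < \<epsilon> / 2"
      using unif[OF sA] unif[OF sB] half_gt_zero[OF \<open>0 < \<epsilon>\<close>] unfolding uniform_limit_iff by blast+
    then show "\<forall>\<^sub>F n in sequentially. \<forall>y\<in>S. \<forall>h. norm ((\<Sum>i<n. case h of (h, k) \<Rightarrow>
        (A (e i) * mode (e i) y) * h + (B (e i) * mode (e i) y) * k) -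
        (case h of (h, k) \<Rightarrow> mode_series A y * h + mode_series B y * k)) \<le> \<epsilon> * norm h"
    proof eventually_elim
      case (elim n)
      show ?case
      proof (intro ballI allI)
        fix y and v :: "complex \<times> complex" assume y: "y \<in> S"
        obtain h k where v: "v = (h, k)" by (cases v)
        let ?a = "(\<Sum>i<n. A (e i) * mode (e i) y) - mode_series A y"
        let ?b = "(\<Sum>i<n. B (e i) * mode (e i) y) - mode_series B y"
        have "(\<Sum>i<n. (A (e i) * mode (e i) y) * h + (B (e i) * mode (e i) y) * k) -
            (mode_series A y * h + mode_series B y * k) = ?a * h + ?b * k"
          unfolding sum.distrib sum_distrib_right[symmetric] by (simp add: algebra_simps)
        also have "norm \<dots> \<le> norm ?a * norm h + norm ?b * norm k"
          by (rule norm_triangle_le) (simp add: norm_mult)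
        also have "\<dots> \<le> \<epsilon> / 2 * norm v + \<epsilon> / 2 * norm v"
        proof (intro add_mono mult_mono)
          show "norm ?a \<le> \<epsilon> / 2" "norm ?b \<le> \<epsilon> / 2"
            using elim y unfolding dist_norm by (simp_all add: less_imp_le)
          show "norm h \<le> norm v" "norm k \<le> norm v"
            unfolding v by (rule norm_fst_le norm_snd_le)+
        qed (use \<open>0 < \<epsilon>\<close> in auto)
        finally show "norm ((\<Sum>i<n. case v of (h, k) \<Rightarrow>
            (A (e i) * mode (e i) y) * h + (B (e i) * mode (e i) y) * k) -
            (case v of (h, k) \<Rightarrow> mode_series A y * h + mode_series B y * k)) \<le> \<epsilon> * norm v"
          by (simp add: v)
      qed
    qed
  qed
  then obtain g where g: "\<And>y. y \<in> S \<Longrightarrow> (\<lambda>n. c (e n) * mode (e n) y) sums g y"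
    "(g has_derivative (\<lambda>(h, k). mode_series A x * h + mode_series B x * k)) (at x within S)"
    using xS by blast
  have eq: "g y = mode_series c y" if y: "y \<in> S" for y
  proof -
    have "\<bar>Im (fst y)\<bar> \<le> R" "\<bar>Im (snd y)\<bar> \<le> R" using S_Im[OF y] r by auto
    from sums_reindex_UNIV[OF e summable_mode_series[OF c this]]
    show ?thesis using g(1)[OF y] by (metis sums_unique2 mode_series_def)
  qed
  have "(mode_series c has_derivative (\<lambda>(h, k). mode_series A x * h + mode_series B x * k)) (at x)"
    using has_derivative_transform_within_open[OF g(2)[unfolded at_within_open[OF xS oS]] oS xS] eq
    by auto
  then show ?thesis by (simp add: A_def B_def)
qed

lemma uniform_limit_mode_series:
  assumes c: "(\<lambda>p. cmod (c p) * decay (- R) p) summable_on UNIV"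
  shows "uniform_limit {x. \<bar>Im (fst x)\<bar> \<le> R \<and> \<bar>Im (snd x)\<bar> \<le> R}
    (\<lambda>X x. \<Sum>p\<in>X. c p * mode p x) (mode_series c) (finite_subsets_at_top UNIV)"
  unfolding mode_series_def
  by (rule Weierstrass_m_test_general[OF _ c]) (auto intro: norm_term_le)

lemma continuous_on_mode [continuous_intros]: "continuous_on S (mode p)"
  unfolding mode_def by (intro continuous_intros)

text \<open>Unlike differentiation this loses no width: the convergence is uniform up to the
  boundary.\<close>

lemma continuous_on_mode_series:
  assumes c: "(\<lambda>p. cmod (c p) * decay (- R) p) summable_on UNIV"
  shows "continuous_on {x. \<bar>Im (fst x)\<bar> \<le> R \<and> \<bar>Im (snd x)\<bar> \<le> R} (mode_series c)"
  by (rule uniform_limit_theorem[OF _ uniform_limit_mode_series[OF c]])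
    (auto intro!: always_eventually continuous_intros)

section \<open>Torus averages as Fourier coefficients\<close>

lemma torus_average_eq:
  assumes "continuous_on (cbox (0, 0) (2 * pi, 2 * pi)) (\<lambda>t. b (of_real (fst t), of_real (snd t)))"
  shows "torus_average b = (1 / (2 * pi)\<^sup>2) *\<^sub>R
    integral (cbox (0, 0) (2 * pi, 2 * pi)) (\<lambda>t. b (of_real (fst t), of_real (snd t)))"
proof -
  let ?f = "\<lambda>t::real \<times> real. b (of_real (fst t), of_real (snd t))"
  let ?C = "cbox (0, 0) (2 * pi, 2 * pi) :: (real \<times> real) set"
  let ?S = "{0..<2 * pi} \<times> {0..<2 * pi} :: (real \<times> real) set"
  have sub: "?S \<subseteq> ?C" by (auto simp: cbox_Pair_iff)
  have box: "box (0, 0) (2 * pi, 2 * pi) \<subseteq> ?S" by (auto simp: box_prod)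
  have "set_integrable lborel ?C ?f"
    using assms by (intro borel_integrable_compact[unfolded set_integrable_def[symmetric]] compact_cbox)
  then have "set_integrable lborel ?S ?f"
    by (rule set_integrable_subset[OF _ _ sub]) (simp add: borel_Times)
  then have "(LINT t : ?S | lborel. ?f t) = integral ?S ?f"
    by (rule set_borel_integral_eq_integral)
  also have "\<dots> = integral ?C ?f"
  proof (rule integral_spike_set)
    \<comment> \<open>The half-open and the closed square differ only on the frontier, a null
      set.\<close>
    have "negligible (?C - ?S)"
      by (rule negligible_subset[OF negligible_frontier_interval]) (use box in blast)
    then show "negligible {x \<in> ?C - ?S. ?f x \<noteq> 0}" by (rule negligible_subset) blast
    show "negligible {x \<in> ?S - ?C. ?f x \<noteq> 0}"
      using sub by (intro negligible_subset[OF negligible_empty]) blast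
  qed
  finally show ?thesis by (simp add: torus_average_def)
qed

lemma continuous_on_torus_mode:
  "continuous_on S (\<lambda>t::real \<times> real. mode p (of_real (fst t), of_real (snd t)))"
  unfolding mode_def by (auto intro!: continuous_intros)

lemma integral_exp_period:
  "integral (cbox 0 (2 * pi)) (\<lambda>t. exp (\<i> * (of_int k * of_real t))) = (if k = 0 then of_real (2 * pi) else 0)"
proof (cases "k = 0")
  case True
  then show ?thesis by (simp add: scaleR_conv_of_real)
next
  case False
  define c where "c = \<i> * complex_of_int k"
  have c: "c \<noteq> 0" "exp (\<i> * (of_int k * z)) = exp (c * z)" for z
    using False by (simp_all add: c_def mult.assoc)
  define G where "G = (\<lambda>t::real. exp (c * of_real t) / c)"
  have "(G has_vector_derivative exp (\<i> * (of_int k * of_real t))) (at t within {0..2 * pi})" for t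
    unfolding G_def c(2) using c(1)
    by (auto intro!: derivative_eq_intros has_vector_derivative_real_field)
  then have "((\<lambda>t. exp (\<i> * (of_int k * of_real t))) has_integral G (2 * pi) - G 0) {0..2 * pi}"
    by (intro fundamental_theorem_of_calculus) auto
  moreover have "G (2 * pi) = G 0"
    using exp_int_2pi[of k 0] by (simp add: G_def c del: exp_int_2pi)
  ultimately show ?thesis using False by (simp add: integral_unique)
qed

lemma integral_mode:
  "integral (cbox (0, 0) (2 * pi, 2 * pi)) (\<lambda>t. mode p (of_real (fst t), of_real (snd t))) =
    (if p = (0, 0) then of_real ((2 * pi)\<^sup>2) else 0)"
proof -
  have "integral (cbox (0, 0) (2 * pi, 2 * pi)) (\<lambda>t. mode p (of_real (fst t), of_real (snd t))) =
      integral (cbox 0 (2 * pi)) (\<lambda>s. integral (cbox 0 (2 * pi)) (\<lambda>t. mode p (of_real s, of_real t)))"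
    using integral_prod_continuous[OF continuous_on_torus_mode, of 0 0 "2 * pi" "2 * pi" p] by simp
  also have "\<dots> = integral (cbox 0 (2 * pi)) (\<lambda>s. exp (\<i> * (of_int (fst p) * of_real s))) *
      integral (cbox 0 (2 * pi)) (\<lambda>t. exp (\<i> * (of_int (snd p) * of_real t)))"
    unfolding mode_def fst_conv snd_conv integral_mult_right integral_mult_left ..
  finally show ?thesis
    unfolding integral_exp_period by (cases p) (auto simp: power2_eq_square)
qed

lemma mode_add: "mode p x * mode q x = mode (p + q) x"
  by (simp add: mode_def algebra_simps flip: exp_add)

text \<open>Orthogonality under uniform convergence. It serves three purposes: the zero average of
  the solution, the description of \<open>fourier2\<close> by averages, and uniqueness.\<close>

lemma torus_average_coefficient:
  assumes c: "(\<lambda>p. cmod (c p)) summable_on UNIV"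
    and b: "\<And>s t :: real. ((\<lambda>p. c p * mode p (of_real s, of_real t)) has_sum b (of_real s, of_real t)) UNIV"
  shows "torus_average (\<lambda>x. mode (- q) x * b x) = c q"
proof -
  let ?C = "cbox (0, 0) (2 * pi, 2 * pi) :: (real \<times> real) set"
  let ?m = "\<lambda>p t. mode p (of_real (fst t), of_real (snd t))"
  let ?f = "\<lambda>t. ?m (- q) t * b (of_real (fst t), of_real (snd t))"
  have unif: "uniform_limit ?C (\<lambda>X t. \<Sum>p\<in>X. c p * ?m (p - q) t) ?f (finite_subsets_at_top UNIV)"
  proof (rule Weierstrass_m_test_general'[OF _ _ c])
    show "norm (c p * ?m (p - q) t) \<le> cmod (c p)" for p and t :: "real \<times> real"
      using norm_term_le[of "(of_real (fst t), of_real (snd t))" 0 "\<lambda>_. c p" "p - q"]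
      by (simp add: decay_def)
    show "((\<lambda>p. c p * ?m (p - q) t) has_sum ?f t) UNIV" for t :: "real \<times> real"
      using has_sum_cmult_right[OF b[of "fst t" "snd t"], of "?m (- q) t"] mode_add[of "- q" _ _]
      by (simp add: mult.left_commute)
  qed
  have cont: "continuous_on ?C (\<lambda>t. \<Sum>p\<in>X. c p * ?m (p - q) t)" for X
    by (intro continuous_intros continuous_on_torus_mode)
  obtain I J where I: "\<And>X. ((\<lambda>t. \<Sum>p\<in>X. c p * ?m (p - q) t) has_integral I X) ?C"
    and J: "(?f has_integral J) ?C" and lim: "(I \<longlongrightarrow> J) (finite_subsets_at_top UNIV)"
    using uniform_limit_integral_cbox[OF unif cont] by auto
  \<comment> \<open>The integrals of the partial sums are constant as soon as q belongs to X, so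
    their limit is this value.\<close>
  have "I X = of_real ((2 * pi)\<^sup>2) * c q" if "finite X" "q \<in> X" for X
  proof -
    have int: "?m p integrable_on ?C" for p
      by (intro integrable_continuous continuous_on_torus_mode)
    have "I X = integral ?C (\<lambda>t. \<Sum>p\<in>X. c p * ?m (p - q) t)"
      using I[of X] by (simp add: integral_unique)
    also have "\<dots> = (\<Sum>p\<in>X. c p * integral ?C (?m (p - q)))"
      using that(1) by (subst integral_sum) (intro integrable_on_mult_right int | simp)+
    also have "\<dots> = (\<Sum>p\<in>X. if p = q then of_real ((2 * pi)\<^sup>2) * c q else 0)"
      unfolding integral_mode by (intro sum.cong) (auto simp: prod_eq_iff)
    finally show ?thesis using that by simp
  qed
  moreover have "\<forall>\<^sub>F X in finite_subsets_at_top UNIV. finite X \<and> q \<in> X"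
    unfolding eventually_finite_subsets_at_top by (intro exI[of _ "{q}"]) auto
  ultimately have "\<forall>\<^sub>F X in finite_subsets_at_top UNIV. I X = of_real ((2 * pi)\<^sup>2) * c q"
    by (auto elim: eventually_mono)
  then have "(I \<longlongrightarrow> of_real ((2 * pi)\<^sup>2) * c q) (finite_subsets_at_top UNIV)"
    by (rule tendsto_eventually)
  with lim have "J = of_real ((2 * pi)\<^sup>2) * c q"
    by (intro tendsto_unique[OF finite_subsets_at_top_neq_bot])
  moreover have "continuous_on ?C ?f"
    by (rule uniform_limit_theorem[OF _ unif]) (auto intro: always_eventually cont)
  ultimately show ?thesis
    using torus_average_eq[of "\<lambda>x. mode (- q) x * b x"] J
    by (simp add: integral_unique scaleR_conv_of_real)
qed

lemma mode_0 [simp]: "mode (0, 0) x = 1"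
  by (simp add: mode_def)

lemma cnj_mode_real: "cnj (mode p (of_real s, of_real t)) = mode (- p) (of_real s, of_real t)"
  by (simp add: mode_def exp_cnj)

lemma mode_periodic:
  "mode p (x + of_real (2 * pi), y) = mode p (x, y)" "mode p (x, y + of_real (2 * pi)) = mode p (x, y)"
  by (simp_all add: mode_def del: of_real_mult)

lemma closure_strip2_subset:
  "closure (strip2 R) \<subseteq> {x. \<bar>Im (fst x)\<bar> \<le> R \<and> \<bar>Im (snd x)\<bar> \<le> R}"
  by (intro closure_minimal closed_Collect_conj closed_Collect_le continuous_intros)
    (auto simp: strip_def)

text \<open>Conjugate symmetry of the coefficients makes the values at real points real, and the
  coefficient at (0, 0) is the average.\<close>

lemma mode_series_in_P0:
  assumes "0 < R" and c: "(\<lambda>p. cmod (c p) * decay (- R) p) summable_on UNIV"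
    and zero: "c (0, 0) = 0" and cnj: "\<And>p. c (- p) = cnj (c p)"
  shows "mode_series c \<in> P0 R"
proof -
  have real: "(\<lambda>p. c p * mode p (of_real s, of_real t)) summable_on UNIV" for s t :: real
    using \<open>0 < R\<close> by (intro summable_mode_series[OF c]) auto
  have "continuous_on (closure (strip2 R)) (mode_series c)"
    by (rule continuous_on_subset[OF continuous_on_mode_series[OF c] closure_strip2_subset])
  moreover have "holomorphic2_on (mode_series c) (strip2 R)"
    unfolding holomorphic2_on_def
    using has_derivative_at_withinI[OF mode_series_has_derivative[OF c]] by blast
  moreover have "mode_series c (x + of_real (2 * pi), y) = mode_series c (x, y) \<and>
      mode_series c (x, y + of_real (2 * pi)) = mode_series c (x, y)" for x y
    unfolding mode_series_def mode_periodic by simp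
  moreover have "mode_series c (of_real s, of_real t) \<in> \<real>" for s t
  proof -
    have "cnj (mode_series c (of_real s, of_real t)) = (\<Sum>\<^sub>\<infinity>p. c (- p) * mode (- p) (of_real s, of_real t))"
      unfolding mode_series_def infsum_cnj[symmetric] by (simp add: cnj cnj_mode_real)
    also have "\<dots> = mode_series c (of_real s, of_real t)"
      unfolding mode_series_def
      by (rule infsum_reindex_bij_betw[where g = uminus and f = "\<lambda>p. c p * mode p (of_real s, of_real t)"])
        (rule bij_uminus)
    finally show ?thesis by (simp add: Reals_cnj_iff)
  qed
  moreover have "torus_average (mode_series c) = 0"
  proof -
    have "(\<lambda>p. cmod (c p)) summable_on UNIV"
    proof (rule summable_on_comparison_test[OF c])
      have "0 \<le> (\<bar>of_int (fst p)\<bar> + \<bar>of_int (snd p)\<bar>) * R" for p :: "int \<times> int"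
        using \<open>0 < R\<close> by (intro mult_nonneg_nonneg) auto
      then have "1 \<le> decay (- R) p" for p
        unfolding decay_def minus_mult_minus one_le_exp_iff .
      then show "cmod (c p) \<le> cmod (c p) * decay (- R) p" for p
        using mult_left_mono[of 1 "decay (- R) p" "cmod (c p)"] by simp
    qed simp
    then have "torus_average (\<lambda>x. mode (- (0, 0)) x * mode_series c x) = c (0, 0)"
      by (rule torus_average_coefficient) (simp add: mode_series_def real)
    then show ?thesis using zero by simp
  qed
  ultimately show ?thesis unfolding P0_def by auto
qed

lemma torus_average_cnj: "torus_average (\<lambda>x. cnj (f x)) = cnj (torus_average f)"
proof -
  let ?I = "\<lambda>x::real \<times> real. indicat_real ({0..<2 * pi} \<times> {0..<2 * pi}) x"
  have "(LBINT x. ?I x *\<^sub>R cnj (f (of_real (fst x), of_real (snd x)))) =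
      (LBINT x. cnj (?I x *\<^sub>R f (of_real (fst x), of_real (snd x))))"
    by simp
  then show ?thesis
    unfolding torus_average_def set_lebesgue_integral_def Bochner_Integration.integral_cnj by simp
qed

lemma torus_average_cong:
  assumes "\<And>s t :: real. f (of_real s, of_real t) = g (of_real s, of_real t)"
  shows "torus_average f = torus_average g"
  unfolding torus_average_def assms ..

text \<open>Both sides read off a coefficient of the same absolutely convergent expansion. The area
  integral translates zero average and reality of b into properties of its coefficients.\<close>

lemma fourier2_torus_average:
  assumes b: "b \<in> P0 R" and "0 < R"
  shows "fourier2 b q = torus_average (\<lambda>x. mode (- q) x * b x)"
proof (rule torus_average_coefficient[symmetric])
  show "(\<lambda>p. cmod (fourier2 b p)) summable_on UNIV"
    using summable_fourier2[OF b \<open>0 < R\<close>, of 0] \<open>0 < R\<close> by (simp add: decay_def)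
  show "((\<lambda>p. fourier2 b p * mode p (of_real s, of_real t)) has_sum b (of_real s, of_real t)) UNIV" for s t :: real
    using \<open>0 < R\<close> by (intro fourier2_has_sum[OF b]) (simp add: strip_def)
qed

lemma fourier2_0: "b \<in> P0 R \<Longrightarrow> 0 < R \<Longrightarrow> fourier2 b (0, 0) = 0"
  using fourier2_torus_average[of b R "(0, 0)"] by (simp add: P0_def)

lemma fourier2_cnj:
  assumes b: "b \<in> P0 R" and "0 < R"
  shows "fourier2 b (- p) = cnj (fourier2 b p)"
proof -
  have "b (of_real s, of_real t) \<in> \<real>" for s t :: real using b by (simp add: P0_def)
  then show ?thesis
    unfolding fourier2_torus_average[OF assms] torus_average_cnj[symmetric]
    by (intro torus_average_cong) (simp add: cnj_mode_real Reals_cnj_iff)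
qed

lemma mode_series_fourier2:
  "b \<in> P0 R \<Longrightarrow> x \<in> strip2 R \<Longrightarrow> mode_series (fourier2 b) x = b x"
  unfolding mode_series_def by (intro infsumI fourier2_has_sum)

section \<open>The cohomological equation\<close>

lemma partial_derivs:
  fixes g :: "complex \<times> complex \<Rightarrow> complex"
  assumes "(g has_derivative (\<lambda>(h, k). A * h + B * k)) (at (x, y))"
  shows "deriv (\<lambda>z. g (z, y)) x = A" and "deriv (\<lambda>w. g (x, w)) y = B"
proof -
  have "((\<lambda>z. (z, y)) has_derivative (\<lambda>h. (h, 0))) (at x)"
    by (intro derivative_intros)
  from has_derivative_compose[OF this assms] show "deriv (\<lambda>z. g (z, y)) x = A"
    by (intro DERIV_imp_deriv) (simp add: has_field_derivative_def)
  have "((\<lambda>w. (x, w)) has_derivative (\<lambda>k. (0, k))) (at y)"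
    by (intro derivative_intros)
  from has_derivative_compose[OF this assms] show "deriv (\<lambda>w. g (x, w)) y = B"
    by (intro DERIV_imp_deriv) (simp add: has_field_derivative_def)
qed

lemma mode_series_transport:
  assumes c: "(\<lambda>p. cmod (c p) * decay (- R) p) summable_on UNIV" and xy: "(x, y) \<in> strip2 R"
  shows "deriv (\<lambda>z. mode_series c (z, y)) x + \<alpha> * deriv (\<lambda>w. mode_series c (x, w)) y =
    mode_series (\<lambda>p. \<i> * (of_int (fst p) + \<alpha> * of_int (snd p)) * c p) (x, y)"
proof -
  \<comment> \<open>The midpoint between the height of the point and R, because frequency factors
    are summable only at a smaller width.\<close>
  define r where "r = (max \<bar>Im x\<bar> \<bar>Im y\<bar> + R) / 2"
  have r: "r < R" "\<bar>Im x\<bar> \<le> r" "\<bar>Im y\<bar> \<le> r" using xy by (auto simp: strip_def r_def)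
  note s = abs_summable_frequency[OF c r(1)]
  have sm: "(\<lambda>p. c p * of_int (fst p) * mode p (x, y)) summable_on UNIV"
    "(\<lambda>p. c p * of_int (snd p) * mode p (x, y)) summable_on UNIV"
    using r by (auto intro!: summable_mode_series[OF s(1)] summable_mode_series[OF s(2)])
  have h: "((\<lambda>p. \<i> * (c p * of_int (fst p) * mode p (x, y))) has_sum
      mode_series (\<lambda>p. \<i> * (c p * of_int (fst p))) (x, y)) UNIV"
    "((\<lambda>p. \<i> * (c p * of_int (snd p) * mode p (x, y))) has_sum
      mode_series (\<lambda>p. \<i> * (c p * of_int (snd p))) (x, y)) UNIV"
    using sm[THEN summable_on_cmult_right[of _ _ \<i>], THEN has_sum_infsum]
    by (simp_all add: mode_series_def mult.assoc)
  have "((\<lambda>p. \<i> * (of_int (fst p) + \<alpha> * of_int (snd p)) * c p * mode p (x, y)) has_sum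
      mode_series (\<lambda>p. \<i> * (c p * of_int (fst p))) (x, y) +
      \<alpha> * mode_series (\<lambda>p. \<i> * (c p * of_int (snd p))) (x, y)) UNIV"
    using has_sum_add[OF h(1) has_sum_cmult_right[OF h(2), of \<alpha>]] by (simp add: algebra_simps)
  then have "mode_series (\<lambda>p. \<i> * (of_int (fst p) + \<alpha> * of_int (snd p)) * c p) (x, y) =
      mode_series (\<lambda>p. \<i> * (c p * of_int (fst p))) (x, y) +
      \<alpha> * mode_series (\<lambda>p. \<i> * (c p * of_int (snd p))) (x, y)"
    unfolding mode_series_def by (rule infsumI)
  then show ?thesis
    using partial_derivs[OF mode_series_has_derivative[OF c xy]] by simp
qed

text \<open>The basis of uniqueness: the averages of a determine the coefficients of any solution
  wherever the frequency is nonzero.\<close>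

lemma solves_cohomological_coefficient:
  assumes h: "h \<in> P0 R" and "0 < R" and sol: "solves_cohomological \<omega> h a (strip2 R)"
  shows "torus_average (\<lambda>x. mode (- q) x * a x) =
    \<i> * (of_int (fst q) + of_real \<omega> * of_int (snd q)) * fourier2 h q"
proof -
  let ?c = "\<lambda>p. \<i> * (of_int (fst p) + of_real \<omega> * of_int (snd p)) * fourier2 h p"
  \<comment> \<open>The coefficients of h are summable at widths below R; half of it suffices for a
    comparison at real points.\<close>
  have c: "(\<lambda>p. cmod (fourier2 h p) * decay (- (R / 2)) p) summable_on UNIV"
    using \<open>0 < R\<close> by (intro summable_fourier2[OF h]) auto
  have s: "(\<lambda>p. cmod (fourier2 h p * of_int (fst p))) summable_on UNIV"
    "(\<lambda>p. cmod (fourier2 h p * of_int (snd p))) summable_on UNIV"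
    using abs_summable_frequency[OF c, of 0] \<open>0 < R\<close> by (simp_all add: decay_def)
  have norm: "(\<lambda>p. cmod (?c p)) summable_on UNIV"
  proof (rule summable_on_comparison_test)
    show "(\<lambda>p. cmod (fourier2 h p * of_int (fst p)) + \<bar>\<omega>\<bar> * cmod (fourier2 h p * of_int (snd p))) summable_on UNIV"
      by (intro summable_on_add summable_on_cmult_right s)
    show "cmod (?c p) \<le> cmod (fourier2 h p * of_int (fst p)) + \<bar>\<omega>\<bar> * cmod (fourier2 h p * of_int (snd p))" for p
    proof -
      have "cmod (?c p) = cmod (fourier2 h p * of_int (fst p) + of_real \<omega> * (fourier2 h p * of_int (snd p)))"
        unfolding norm_mult[of "_ * _" "fourier2 h p"] norm_mult[of \<i>]
        by (simp add: algebra_simps flip: norm_mult)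
      also have "\<dots> \<le> cmod (fourier2 h p * of_int (fst p)) + \<bar>\<omega>\<bar> * cmod (fourier2 h p * of_int (snd p))"
        by (rule norm_triangle_le) (simp add: norm_mult)
      finally show ?thesis .
    qed
  qed simp
  show ?thesis
  proof (rule torus_average_coefficient[OF norm])
    fix s t :: real
    have st: "of_real s \<in> strip r" "of_real t \<in> strip r" if "0 < r" for r
      using that by (simp_all add: strip_def)
    have ev: "\<forall>\<^sub>F z in nhds (of_real u). z \<in> strip R" for u
      using \<open>0 < R\<close> by (intro eventually_nhds_in_open open_strip) (simp add: strip_def)
    \<comment> \<open>Derivatives are local, and h agrees with its Fourier series near real
      points.\<close>
    have "deriv (\<lambda>z. h (z, of_real t)) (of_real s) = deriv (\<lambda>z. mode_series (fourier2 h) (z, of_real t)) (of_real s)"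
      by (intro deriv_cong_ev refl eventually_mono[OF ev])
        (use st(2)[OF \<open>0 < R\<close>] mode_series_fourier2[OF h] in auto)
    moreover have "deriv (\<lambda>w. h (of_real s, w)) (of_real t) = deriv (\<lambda>w. mode_series (fourier2 h) (of_real s, w)) (of_real t)"
      by (intro deriv_cong_ev refl eventually_mono[OF ev])
        (use st(1)[OF \<open>0 < R\<close>] mode_series_fourier2[OF h] in auto)
    moreover have "deriv (\<lambda>z. h (z, of_real t)) (of_real s) + of_real \<omega> * deriv (\<lambda>w. h (of_real s, w)) (of_real t)
        = a (of_real s, of_real t)"
      using sol st[OF \<open>0 < R\<close>] unfolding solves_cohomological_def by blast
    ultimately have "a (of_real s, of_real t) = mode_series ?c (of_real s, of_real t)"
      using mode_series_transport[OF c, of "of_real s" "of_real t" "of_real \<omega>"] st[of "R / 2"] \<open>0 < R\<close>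
      by simp
    moreover have "(\<lambda>p. ?c p * mode p (of_real s, of_real t)) summable_on UNIV"
      using norm by (intro summable_mode_series[of _ 0]) (simp_all add: decay_def)
    ultimately show "((\<lambda>p. ?c p * mode p (of_real s, of_real t)) has_sum a (of_real s, of_real t)) UNIV"
      using has_sum_infsum[of "\<lambda>p. ?c p * mode p (of_real s, of_real t)" UNIV]
      by (simp only: mode_series_def)
  qed
qed

section \<open>The solution, its uniqueness and its norm\<close>

context irrational_unit
begin

text \<open>At (0, 0) the frequency vanishes and the value is fixed by the zero average
  instead.\<close>

definition solution_coeff :: "(complex \<times> complex \<Rightarrow> complex) \<Rightarrow> int \<times> int \<Rightarrow> complex" where
  "solution_coeff a p = (if p = (0, 0) then 0
     else fourier2 a p / (\<i> * (of_int (fst p) + of_real \<omega> * of_int (snd p))))"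

lemma norm_frequency: "cmod (of_int (fst p) + of_real \<omega> * of_int (snd p)) = small_div p"
proof -
  have "of_int (fst p) + of_real \<omega> * of_int (snd p) =
      (of_real (of_int (fst p) + \<omega> * of_int (snd p)) :: complex)" by simp
  then show ?thesis unfolding small_div_def by (metis norm_of_real)
qed

lemma frequency_complex_nonzero:
  "p \<noteq> (0, 0) \<Longrightarrow> of_int (fst p) + of_real \<omega> * of_int (snd p) \<noteq> (0 :: complex)"
  using frequency_nonzero[of "fst p" "snd p"] norm_frequency[of p]
  by (auto simp: small_div_def)

lemma solution_coeff_eq:
  assumes "a \<in> P0 \<rho>" "0 < \<rho>"
  shows "\<i> * (of_int (fst p) + of_real \<omega> * of_int (snd p)) * solution_coeff a p = fourier2 a p"
  using frequency_complex_nonzero[of p] fourier2_0[OF assms] by (auto simp: solution_coeff_def)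

lemma solution_coeff_cnj:
  assumes "a \<in> P0 \<rho>" "0 < \<rho>"
  shows "solution_coeff a (- p) = cnj (solution_coeff a p)"
proof -
  define d where "d = (of_int (fst p) + of_real \<omega> * of_int (snd p) :: complex)"
  have "of_int (fst (- p)) + of_real \<omega> * of_int (snd (- p)) = - d" "cnj d = d"
    by (simp_all add: d_def)
  moreover have "- p = (0, 0) \<longleftrightarrow> p = (0, 0)" by (cases p) simp
  ultimately show ?thesis
    unfolding solution_coeff_def fourier2_cnj[OF assms] d_def[symmetric] by simp
qed

lemma summable_small_div:
  assumes "0 < \<delta>" and brj: "semi_Brjuno ((1 + \<omega>) * \<delta>) \<omega>"
  shows "(\<lambda>p. decay \<delta> p / small_div p) summable_on - {(0, 0)}"
    and "infsum (\<lambda>p. decay \<delta> p / small_div p) (- {(0, 0)}) \<le>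
      2 * exp (\<delta> / 2) * Brj \<omega> ((1 + \<omega>) * \<delta>) + remainder \<delta>"
proof -
  have le: "(\<Sum>p\<in>F. decay \<delta> p / small_div p) \<le> 2 * exp (\<delta> / 2) * Brj \<omega> ((1 + \<omega>) * \<delta>) + remainder \<delta>"
    if "finite F" "F \<subseteq> - {(0, 0)}" for F
    using that by (intro sum_small_div_le[OF assms]) auto
  show summ: "(\<lambda>p. decay \<delta> p / small_div p) summable_on - {(0, 0)}"
    using le by (intro nonneg_bdd_above_summable_on bdd_aboveI2) auto
  show "infsum (\<lambda>p. decay \<delta> p / small_div p) (- {(0, 0)}) \<le>
      2 * exp (\<delta> / 2) * Brj \<omega> ((1 + \<omega>) * \<delta>) + remainder \<delta>"
    by (rule infsum_le_finite_sums[OF summ le])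
qed

text \<open>Here the widths meet: decay at rate \<rho> from a against growth at rate \<rho> -
  \<delta> of the modes leaves decay at rate \<delta> to fight the small divisor.\<close>

lemma norm_solution_coeff_le:
  assumes "a \<in> P0 \<rho>" "0 < \<rho>" "p \<noteq> (0, 0)"
  shows "cmod (solution_coeff a p) * decay (- (\<rho> - \<delta>)) p \<le> strip_norm \<rho> a * (decay \<delta> p / small_div p)"
proof -
  have "cmod (solution_coeff a p) * decay (- (\<rho> - \<delta>)) p =
      cmod (fourier2 a p) / small_div p * decay (\<delta> - \<rho>) p"
    using assms(3) by (simp add: solution_coeff_def norm_divide norm_mult norm_frequency)
  also have "\<dots> \<le> (strip_norm \<rho> a * decay \<rho> p) / small_div p * decay (\<delta> - \<rho>) p"
    by (intro mult_right_mono divide_right_mono norm_fourier2_le[OF assms(1,2)]) auto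
  also have "\<dots> = strip_norm \<rho> a * (decay \<delta> p / small_div p)"
    using decay_add[of \<rho> p "\<delta> - \<rho>"] by (simp add: field_simps)
  finally show ?thesis .
qed

lemma solution_coeff_sum:
  assumes a: "a \<in> P0 \<rho>" and "0 < \<rho>" and "0 < \<delta>" and brj: "semi_Brjuno ((1 + \<omega>) * \<delta>) \<omega>"
  shows "(\<lambda>p. cmod (solution_coeff a p) * decay (- (\<rho> - \<delta>)) p) summable_on UNIV"
    and "(\<Sum>\<^sub>\<infinity>p. cmod (solution_coeff a p) * decay (- (\<rho> - \<delta>)) p) \<le>
      (2 * exp (\<delta> / 2) * Brj \<omega> ((1 + \<omega>) * \<delta>) + remainder \<delta>) * strip_norm \<rho> a"
proof -
  let ?t = "\<lambda>p. cmod (solution_coeff a p) * decay (- (\<rho> - \<delta>)) p"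
  let ?u = "\<lambda>p. strip_norm \<rho> a * (decay \<delta> p / small_div p)"
  note s = summable_small_div[OF \<open>0 < \<delta>\<close> brj]
  have u: "?u summable_on - {(0, 0)}" by (rule summable_on_cmult_right[OF s(1)])
  have t: "?t summable_on - {(0, 0)}"
    by (rule summable_on_comparison_test[OF u]) (use norm_solution_coeff_le[OF a \<open>0 < \<rho>\<close>] in auto)
  have zero: "?t p = 0" if "p \<in> UNIV - - {(0, 0)}" for p
    using that by (simp add: solution_coeff_def)
  show "?t summable_on UNIV"
    using t zero by (subst summable_on_cong_neutral[of "- {(0, 0)}" UNIV ?t ?t]) auto
  have "infsum ?t UNIV = infsum ?t (- {(0, 0)})"
    using zero by (intro infsum_cong_neutral) auto
  also have "\<dots> \<le> infsum ?u (- {(0, 0)})"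
    by (rule infsum_mono[OF t u]) (use norm_solution_coeff_le[OF a \<open>0 < \<rho>\<close>] in auto)
  also have "\<dots> = strip_norm \<rho> a * infsum (\<lambda>p. decay \<delta> p / small_div p) (- {(0, 0)})"
    by (rule infsum_cmult_right[OF s(1)])
  also have "\<dots> \<le> strip_norm \<rho> a * (2 * exp (\<delta> / 2) * Brj \<omega> ((1 + \<omega>) * \<delta>) + remainder \<delta>)"
    by (rule mult_left_mono[OF s(2) strip_norm_nonneg[OF a \<open>0 < \<rho>\<close>]])
  finally show "infsum ?t UNIV \<le> (2 * exp (\<delta> / 2) * Brj \<omega> ((1 + \<omega>) * \<delta>) + remainder \<delta>) * strip_norm \<rho> a"
    by (simp add: mult.commute)
qed

lemma cohomological_solution:
  assumes a: "a \<in> P0 \<rho>" and "0 < \<rho>" "0 < \<delta>" "\<delta> < \<rho>" and brj: "semi_Brjuno ((1 + \<omega>) * \<delta>) \<omega>"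
  defines "g \<equiv> mode_series (solution_coeff a)"
  shows "g \<in> P0 (\<rho> - \<delta>)"
    and "solves_cohomological \<omega> g a (strip2 (\<rho> - \<delta>))"
    and "\<And>h p. h \<in> P0 (\<rho> - \<delta>) \<Longrightarrow> solves_cohomological \<omega> h a (strip2 (\<rho> - \<delta>)) \<Longrightarrow>
      p \<in> closure (strip2 (\<rho> - \<delta>)) \<Longrightarrow> h p = g p"
    and "strip_norm (\<rho> - \<delta>) g \<le>
      (2 * exp (\<delta> / 2) * Brj \<omega> ((1 + \<omega>) * \<delta>) + remainder \<delta>) * strip_norm \<rho> a"
proof -
  define R where "R = \<rho> - \<delta>"
  have R: "0 < R" "R < \<rho>" using assms by (auto simp: R_def)
  note sum = solution_coeff_sum[OF a \<open>0 < \<rho>\<close> \<open>0 < \<delta>\<close> brj, folded R_def]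
  show gP: "g \<in> P0 (\<rho> - \<delta>)"
    unfolding g_def R_def[symmetric]
    by (rule mode_series_in_P0[OF R(1) sum(1) _ solution_coeff_cnj[OF a \<open>0 < \<rho>\<close>]])
      (simp add: solution_coeff_def)
  have in_strip: "z \<in> strip \<rho>" if "z \<in> strip R" for z
    using that R(2) by (simp add: strip_def)
  show "solves_cohomological \<omega> g a (strip2 (\<rho> - \<delta>))"
    unfolding solves_cohomological_def R_def[symmetric]
  proof (clarify)
    fix x y assume xy: "x \<in> strip R" "y \<in> strip R"
    have "deriv (\<lambda>z. g (z, y)) x + of_real \<omega> * deriv (\<lambda>w. g (x, w)) y = mode_series (fourier2 a) (x, y)"
      unfolding g_def using xy solution_coeff_eq[OF a \<open>0 < \<rho>\<close>]
      by (subst mode_series_transport[OF sum(1)]) auto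
    also have "\<dots> = a (x, y)"
      using xy in_strip by (intro mode_series_fourier2[OF a]) auto
    finally show "deriv (\<lambda>z. g (z, y)) x + of_real \<omega> * deriv (\<lambda>w. g (x, w)) y = a (x, y)" .
  qed
  show "h p = g p" if h: "h \<in> P0 (\<rho> - \<delta>)" and sol: "solves_cohomological \<omega> h a (strip2 (\<rho> - \<delta>))"
    and p: "p \<in> closure (strip2 (\<rho> - \<delta>))" for h p
  proof -
    have coeff: "fourier2 h q = solution_coeff a q" for q
    proof (cases "q = (0, 0)")
      \<comment> \<open>The equation says nothing about this coefficient; both values are zero
        because averages vanish.\<close>
      case True
      then show ?thesis using fourier2_0[OF h] R(1) by (simp add: solution_coeff_def R_def)
    next
      case False
      have "\<i> * (of_int (fst q) + of_real \<omega> * of_int (snd q)) * fourier2 h q = fourier2 a q"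
        using solves_cohomological_coefficient[OF h _ sol, of q] R(1)
          fourier2_torus_average[OF a \<open>0 < \<rho>\<close>, of q] by (simp add: R_def)
      then have "\<i> * (of_int (fst q) + of_real \<omega> * of_int (snd q)) * fourier2 h q =
          \<i> * (of_int (fst q) + of_real \<omega> * of_int (snd q)) * solution_coeff a q"
        by (simp only: solution_coeff_eq[OF a \<open>0 < \<rho>\<close>])
      then show ?thesis using frequency_complex_nonzero[OF False] by simp
    qed
    have "fourier2 h = solution_coeff a" using coeff by (rule ext)
    then have eq: "h x - g x = 0" if "x \<in> strip2 (\<rho> - \<delta>)" for x
      using mode_series_fourier2[OF h that] by (simp add: g_def)
    \<comment> \<open>Equal coefficients give equality on the open strip, and continuity extends it
      to the closure.\<close>
    have "continuous_on (closure (strip2 (\<rho> - \<delta>))) (\<lambda>x. h x - g x)"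
      using h gP by (intro continuous_intros) (auto simp: P0_def)
    from continuous_constant_on_closure[OF this eq p] show ?thesis by simp
  qed
  show "strip_norm (\<rho> - \<delta>) g \<le>
      (2 * exp (\<delta> / 2) * Brj \<omega> ((1 + \<omega>) * \<delta>) + remainder \<delta>) * strip_norm \<rho> a"
    unfolding R_def[symmetric] strip_norm_def[of R]
  proof (rule cSUP_least)
    have "(0, 0) \<in> closure (strip2 R)"
      using R(1) by (intro strip2_subset_closure) (simp add: strip_def)
    then show "closure (strip2 R) \<noteq> {}" by (metis empty_iff)
    fix x assume "x \<in> closure (strip2 R)"
    then have x: "\<bar>Im (fst x)\<bar> \<le> R" "\<bar>Im (snd x)\<bar> \<le> R"
      using subsetD[OF closure_strip2_subset] by simp_all
    have "cmod (g x) \<le> (\<Sum>\<^sub>\<infinity>p. cmod (solution_coeff a p) * decay (- R) p)"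
      unfolding g_def mode_series_def
      by (rule norm_infsum_le[OF has_sum_infsum[OF summable_mode_series[OF sum(1) x]]
            has_sum_infsum[OF sum(1)]]) (rule norm_term_le[OF x])
    then show "cmod (g x) \<le> (2 * exp (\<delta> / 2) * Brj \<omega> ((1 + \<omega>) * \<delta>) + remainder \<delta>) * strip_norm \<rho> a"
      using sum(2) by linarith
  qed
qed

end

theorem theorem2p6:
  fixes \<omega> :: real
  assumes "0 < \<omega>" and "\<omega> < 1" and "\<omega> \<notin> \<rat>"
  shows "\<exists>r1 r2 r3 :: real \<Rightarrow> real.
    r1 \<in> O[at_right 0](\<lambda>\<delta>. \<delta>) \<and> r2 \<in> O[at_right 0](\<lambda>\<delta>. \<delta>) \<and> r3 \<in> O[at_right 0](\<lambda>\<delta>. \<delta>) \<and>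
    (\<forall>\<rho> > 0. \<forall>a \<in> P0 \<rho>. \<forall>\<delta>. 0 < \<delta> \<and> \<delta> < \<rho> \<and> semi_Brjuno ((1 + \<omega>) * \<delta>) \<omega> \<longrightarrow>
      (\<exists>g \<in> P0 (\<rho> - \<delta>).
        solves_cohomological \<omega> g a (strip2 (\<rho> - \<delta>)) \<and>
        (\<forall>h \<in> P0 (\<rho> - \<delta>). solves_cohomological \<omega> h a (strip2 (\<rho> - \<delta>)) \<longrightarrow>
           (\<forall>p \<in> closure (strip2 (\<rho> - \<delta>)). h p = g p)) \<and>
        strip_norm (\<rho> - \<delta>) g \<le>
          ((2 + r1 \<delta>) * Brj \<omega> ((1 + \<omega>) * \<delta>)
           + (8 / (1 + \<omega>)\<^sup>2 + r2 \<delta>) * (1 / \<delta>\<^sup>2)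
           + (4 / (1 + \<omega>) + 2 / (1 - \<omega>) + r3 \<delta>) * (1 / \<delta>) * ln (1 / \<delta>))
          * strip_norm \<rho> a))"
proof -
  interpret irrational_unit \<omega> using assms by unfold_locales
  \<comment> \<open>So that 2 + r1 is the factor 2 exp (\<delta> / 2) of \<open>Brj\<close> in the
    lattice sum.\<close>
  define r1 where "r1 = (\<lambda>\<delta>::real. 2 * exp (\<delta> / 2) - 2)"
  \<comment> \<open>The excess of the remainder over the allowed coefficient: the bound then holds
    for every \<delta>, while r2 vanishes for all small \<delta>.\<close>
  define r2 where "r2 = (\<lambda>\<delta>. max 0 (\<delta>\<^sup>2 * remainder \<delta> - 8 / (1 + \<omega>)\<^sup>2))"
  define K where "K = 4 / (1 + \<omega>) + 2 / (1 - \<omega>)"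
  \<comment> \<open>For \<open>\<delta> \<ge> 1\<close> the logarithm is not positive, so its coefficient is cancelled.\<close>
  define r3 where "r3 = (\<lambda>\<delta>::real. if \<delta> < 1 then 0 else - K)"
  have "0 < K" using assms by (simp add: K_def add_pos_pos)
  have O1: "r1 \<in> O[at_right 0](\<lambda>\<delta>. \<delta>)" unfolding r1_def by real_asymp
  \<comment> \<open>Both r2 and r3 vanish near 0, so the constant 0 witnesses the order.\<close>
  have O2: "r2 \<in> O[at_right 0](\<lambda>\<delta>. \<delta>)"
    by (rule bigoI[of _ 0], rule eventually_mono[OF eventually_remainder_le]) (simp add: r2_def)
  have O3: "r3 \<in> O[at_right 0](\<lambda>\<delta>. \<delta>)"
    by (rule bigoI[of _ 0], rule eventually_mono[OF eventually_at_right_real[of 0 1]])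
      (simp_all add: r3_def)
  have \<Gamma>: "2 * exp (\<delta> / 2) * Brj \<omega> ((1 + \<omega>) * \<delta>) + remainder \<delta> \<le>
      (2 + r1 \<delta>) * Brj \<omega> ((1 + \<omega>) * \<delta>) + (8 / (1 + \<omega>)\<^sup>2 + r2 \<delta>) * (1 / \<delta>\<^sup>2)
      + (K + r3 \<delta>) * (1 / \<delta>) * ln (1 / \<delta>)" if "0 < \<delta>" for \<delta>
  proof -
    have "\<delta>\<^sup>2 * remainder \<delta> \<le> 8 / (1 + \<omega>)\<^sup>2 + r2 \<delta>" by (simp add: r2_def)
    then have "\<delta>\<^sup>2 * remainder \<delta> * (1 / \<delta>\<^sup>2) \<le> (8 / (1 + \<omega>)\<^sup>2 + r2 \<delta>) * (1 / \<delta>\<^sup>2)"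
      by (rule mult_right_mono) simp
    moreover have "\<delta>\<^sup>2 * remainder \<delta> * (1 / \<delta>\<^sup>2) = remainder \<delta>" using that by simp
    moreover have "0 \<le> (K + r3 \<delta>) * (1 / \<delta>) * ln (1 / \<delta>)"
    proof (cases "\<delta> < 1")
      case True
      then show ?thesis using that \<open>0 < K\<close> by (intro mult_nonneg_nonneg ln_ge_zero) (auto simp: r3_def)
    qed (simp add: r3_def)
    ultimately show ?thesis by (simp add: r1_def)
  qed
  show ?thesis
  proof (intro exI conjI, rule O1, rule O2, rule O3, intro allI ballI impI, elim conjE)
    fix \<rho> a \<delta>
    assume "0 < \<rho>" "a \<in> P0 \<rho>" "0 < \<delta>" "\<delta> < \<rho>" "semi_Brjuno ((1 + \<omega>) * \<delta>) \<omega>"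
    note sol = cohomological_solution[OF \<open>a \<in> P0 \<rho>\<close> \<open>0 < \<rho>\<close> \<open>0 < \<delta>\<close> \<open>\<delta> < \<rho>\<close> \<open>semi_Brjuno ((1 + \<omega>) * \<delta>) \<omega>\<close>]
    note bound = order_trans[OF sol(4) mult_right_mono[OF \<Gamma>[OF \<open>0 < \<delta>\<close>]
          strip_norm_nonneg[OF \<open>a \<in> P0 \<rho>\<close> \<open>0 < \<rho>\<close>]], unfolded K_def]
    show "\<exists>g\<in>P0 (\<rho> - \<delta>).
        solves_cohomological \<omega> g a (strip2 (\<rho> - \<delta>)) \<and>
        (\<forall>h \<in> P0 (\<rho> - \<delta>). solves_cohomological \<omega> h a (strip2 (\<rho> - \<delta>)) \<longrightarrow>
           (\<forall>p \<in> closure (strip2 (\<rho> - \<delta>)). h p = g p)) \<and>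
        strip_norm (\<rho> - \<delta>) g \<le>
          ((2 + r1 \<delta>) * Brj \<omega> ((1 + \<omega>) * \<delta>)
           + (8 / (1 + \<omega>)\<^sup>2 + r2 \<delta>) * (1 / \<delta>\<^sup>2)
           + (4 / (1 + \<omega>) + 2 / (1 - \<omega>) + r3 \<delta>) * (1 / \<delta>) * ln (1 / \<delta>))
          * strip_norm \<rho> a"
      using sol(1-3) bound by (intro bexI[OF _ sol(1)] conjI) blast+
  qed
qed

end
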